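(* Let $p$ be an odd prime and let $c$ be an integer. Then \[ \sum_{\substack{r\in\mathbb{Z},\ |r|<2\sqrt p,\\ r\equiv c\pmod 4}}H(4p-r^2) =\begin{cases} \frac{p+1}{3}, & c\equiv\pm 1\pmod 4,\\ \frac{5p-7}{6}, & c\equiv p+1\pmod 4,\\ \frac{p+1}{2}, & c\equiv p-1\pmod 4. \end{cases} \]
   Context: $H(N)$ denotes the Hurwitz class number: for an integer $N\ge 0$, $H(0)=-1/12$; $H(N)=0$ if $N\equiv 1,2\pmod 4$; otherwise $H(N)$ is the number of $\mathrm{SL}_2(\mathbb{Z})$-equivalence classes of (not necessarily primitive) positive definite binary quadratic forms of discriminant $-N$, where classes containing a multiple of $x^2+y^2$ are counted with weight $1/2$ and classes containing a multiple of $x^2+xy+y^2$ are counted with weight $1/3$. The sum runs over all integers $r$ (positive, negative and zero) satisfying the stated conditions. *)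

theory Defs
  imports "HOL-Number_Theory.Number_Theory"
begin

text \<open>Binary quadratic forms a x^2 + b x y + c y^2 are represented by triples (a, b, c).\<close>
type_synonym bqf = "int \<times> int \<times> int"

text \<open>Substitution (x, y) := (alpha x + beta y, gamma x + delta y) applied to the form f.\<close>
fun bqf_subst :: "int \<Rightarrow> int \<Rightarrow> int \<Rightarrow> int \<Rightarrow> bqf \<Rightarrow> bqf" where
  "bqf_subst \<alpha> \<beta> \<gamma> \<delta> (a, b, c) =
     (a*\<alpha>^2 + b*\<alpha>*\<gamma> + c*\<gamma>^2,
      2*a*\<alpha>*\<beta> + b*(\<alpha>*\<delta> + \<beta>*\<gamma>) + 2*c*\<gamma>*\<delta>,
      a*\<beta>^2 + b*\<beta>*\<delta> + c*\<delta>^2)"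

definition sl2_equiv :: "bqf rel" where
  "sl2_equiv = {(f, g). \<exists>\<alpha> \<beta> \<gamma> \<delta>. \<alpha>*\<delta> - \<beta>*\<gamma> = 1 \<and> g = bqf_subst \<alpha> \<beta> \<gamma> \<delta> f}"

definition posdef_forms :: "int \<Rightarrow> bqf set" where
  "posdef_forms N = {(a, b, c). b^2 - 4*a*c = -N \<and> b^2 - 4*a*c < 0 \<and> a > 0}"

definition bqf_classes :: "int \<Rightarrow> bqf set set" where
  "bqf_classes N = posdef_forms N // sl2_equiv"

definition class_weight :: "bqf set \<Rightarrow> real" where
  "class_weight C =
     (if \<exists>k. (k, 0, k) \<in> C then 1/2
      else if \<exists>k. (k, k, k) \<in> C then 1/3 else 1)"

definition hurwitz :: "int \<Rightarrow> real" where
  "hurwitz N =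
     (if N = 0 then -1/12
      else if N mod 4 = 1 \<or> N mod 4 = 2 then 0
      else (\<Sum>C\<in>bqf_classes N. class_weight C))"

end

theory Submission
  imports Defs
begin

text \<open>A form of discriminant r^2 - 4 p together with the number r is an integral 2 x 2 matrix of determinant p
  and trace r, up to conjugation. Selling reduction therefore turns 3 times the sum of \<phi>(r) H(4 p - r^2) into a
  sum of \<phi>(a + d) over the solutions of a d + b c = p in a polyhedral cone. For even \<phi>, unimodular
  substitutions in the manner of Liouville convert it into the sum of
  \<phi>(a + d - b) - \<phi>(a + d + b) over the positive solutions of a d + b c = p, plus explicit terms coming from
  the walls of the cones. For \<phi>(r) = 1 and for the indicator of odd r the new summands vanish, and for
  \<phi>(r) = cos(\<pi> r / 2) the sum is evaluated by Liouville's classical identity. These three functions,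
  together with the symmetry r -> -r, determine the sums over all residue classes modulo 4.\<close>

section \<open>Solutions of a d + b c = p\<close>

text \<open>The sum over r is accessible because the determinant p stays fixed while the trace may
  vary, and two kinds of moves exploit this. Conjugation by a unipotent matrix keeps the trace and
  identifies one cone with another. Multiplying the matrix M with rows (a, -b), (c, d) by the matrix
  U with rows (1, 0), (1, 1), or by its inverse, changes the trace by -b or b; this is the origin of
  the summands \<phi>(a + d - b) and \<phi>(a + d + b). One obstacle is the walls, where entries
  coincide and a substitution leaves the positive cone. Primality controls them: on such a wall a d
  + b c factors, so some entry is 1 and only a one-parameter family is left. The other obstacle is
  the solutions whose diagonal entries have opposite signs. They occur among the reduced matrices
  and also in the image of M -> M U, but in regions of different shape. Comparing these regions is
  what requires \<phi> to be even.\<close>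

definition sols :: "int \<Rightarrow> (int \<Rightarrow> int \<Rightarrow> int \<Rightarrow> int \<Rightarrow> bool) \<Rightarrow> (int \<times> int \<times> int \<times> int) set" where
  "sols p Q = {(a, b, c, d). 0 < a \<and> 0 < b \<and> 0 < c \<and> 0 < d \<and> a * d + b * c = p \<and> Q a b c d}"

lemma le_mult_pos_int:
  fixes x y :: int assumes "0 < x" "0 < y" shows "x \<le> x * y" "y \<le> x * y"
  using assms by (simp_all add: mult_le_cancel_left1 mult_le_cancel_right1)

lemma finite_sols [simp]: "finite (sols p Q)"
proof (rule finite_subset)
  show "sols p Q \<subseteq> {0..p} \<times> {0..p} \<times> {0..p} \<times> {0..p}"
  proof (clarsimp simp: sols_def, intro conjI)
    fix a b c d :: int
    assume "0 < a" "0 < b" "0 < c" "0 < d"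
    then have "a \<le> a * d" "d \<le> a * d" "b \<le> b * c" "c \<le> b * c" "0 < a * d" "0 < b * c"
      by (simp_all add: le_mult_pos_int)
    then show "a \<le> a * d + b * c" "b \<le> a * d + b * c" "c \<le> a * d + b * c" "d \<le> a * d + b * c"
      by linarith+
  qed
qed simp

definition osum :: "(int \<Rightarrow> real) \<Rightarrow> int \<Rightarrow> (int \<Rightarrow> int \<Rightarrow> int \<Rightarrow> int \<Rightarrow> bool) \<Rightarrow> real" where
  "osum \<phi> p Q = (\<Sum>(a, b, c, d)\<in>sols p Q. \<phi> (a + d))"

lemma sum_sols_of_bool:
  "(\<Sum>(a, b, c, d)\<in>sols p Q. f a b c d) =
   (\<Sum>(a, b, c, d)\<in>sols p (\<lambda>_ _ _ _. True). of_bool (Q a b c d) * (f a b c d :: real))"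
  by (rule sum.mono_neutral_cong_left, simp) (auto simp: sols_def)

lemma osum_of_bool:
  "osum \<phi> p Q = (\<Sum>(a, b, c, d)\<in>sols p (\<lambda>_ _ _ _. True). of_bool (Q a b c d) * \<phi> (a + d))"
  unfolding osum_def by (rule sum_sols_of_bool)

text \<open>The substitution is conjugation of the matrix with rows (a, -b), (c, d) by a unipotent matrix,
  so it preserves the trace a + d.\<close>
lemma osum_conj:
  assumes "\<And>a b c d. Q a b c d = R (a - c) (b + c + d - a) c (d + c)"
  shows "osum \<phi> p (\<lambda>a b c d. 2 * c \<le> a - d \<and> a - d < b + c \<and> Q a b c d) =
         osum \<phi> p (\<lambda>a b c d. c < d \<and> d \<le> a \<and> R a b c d)"
  unfolding osum_def
  by (rule sum.reindex_bij_witness[where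
        i = "\<lambda>(a, b, c, d). (a + c, b + c + a - d, c, d - c)" and
        j = "\<lambda>(a, b, c, d). (a - c, b + c + d - a, c, d + c)"])
     (auto simp: sols_def algebra_simps assms)

section \<open>Wall points and a linear relation between cone sums\<close>

lemma prime_factor_one:
  fixes x y :: int assumes "prime p" "x * y = int p" "0 < x" "1 < y" shows "x = 1"
proof -
  have "nat x * nat y = p" using assms
    by (metis nat_int nat_mult_distrib order_less_imp_le)
  then have "nat x = 1 \<or> nat y = 1" using \<open>prime p\<close> by (metis prime_product)
  then show ?thesis using assms by auto
qed

text \<open>On each wall a d + b c becomes a product: b = d gives d (a + c), and a = b + c + d gives
  (d + b) (d + c). A sum of two positive entries exceeds 1, so in the first four cases the other
  factor is 1, while the last two cases contradict primality.\<close>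

lemma sols_diag:
  assumes "prime p" "(a, b, c, d) \<in> sols (int p) Q"
  shows "b = d \<Longrightarrow> d = 1" "c = d \<Longrightarrow> d = 1" "b = a \<Longrightarrow> a = 1" "c = a \<Longrightarrow> a = 1"
        "a \<noteq> b + c + d" "d \<noteq> a + b + c"
proof -
  have h: "0 < a" "0 < b" "0 < c" "0 < d" "a * d + b * c = int p"
    using assms(2) by (auto simp: sols_def)
  show "b = d \<Longrightarrow> d = 1" using prime_factor_one[OF \<open>prime p\<close>, of d "a + c"] h by (auto simp: algebra_simps)
  show "c = d \<Longrightarrow> d = 1" using prime_factor_one[OF \<open>prime p\<close>, of d "a + b"] h by (auto simp: algebra_simps)
  show "b = a \<Longrightarrow> a = 1" using prime_factor_one[OF \<open>prime p\<close>, of a "d + c"] h by (auto simp: algebra_simps)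
  show "c = a \<Longrightarrow> a = 1" using prime_factor_one[OF \<open>prime p\<close>, of a "d + b"] h by (auto simp: algebra_simps)
  show "a \<noteq> b + c + d" using prime_factor_one[OF \<open>prime p\<close>, of "d + b" "d + c"] h by (auto simp: algebra_simps)
  show "d \<noteq> a + b + c" using prime_factor_one[OF \<open>prime p\<close>, of "a + b" "a + c"] h by (auto simp: algebra_simps)
qed

text \<open>The coefficient of \<phi>(a + d) when everything in \<open>osum_relation\<close> is moved to the left-hand side and the
  two instances of \<open>osum_conj\<close> used in its proof are added with the factors -6 and 2. These factors are chosen
  such that the coefficient vanishes after averaging over the swaps of a with d and of b with c.\<close>
definition balance :: "int \<Rightarrow> int \<Rightarrow> int \<Rightarrow> int \<Rightarrow> int" where
  "balance a b c d =
     of_bool (c > d) - of_bool (a > b) - 2 * of_bool (a > b + c + d)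
     - 2 * of_bool (d < a \<and> a - d < 2 * b \<and> a - d < 2 * c) - 3 * of_bool (a = d)
     - 2 * of_bool (d < a \<and> a < b \<and> a - d < 2 * c) + 2 * of_bool (d \<le> a \<and> d < b \<and> d < c)
     - 6 * of_bool (2 * c \<le> a - d \<and> a - d < b + c) + 6 * of_bool (c < d \<and> d \<le> a)
     + 2 * of_bool (2 * c \<le> a - d \<and> a - d < b + c \<and> a > b) - 2 * of_bool (c < d \<and> d \<le> a \<and> b < d)
     + 5 * of_bool (b = d) - 2 * of_bool (b = d \<and> c = d)"

text \<open>Every indicator in \<open>balance\<close> compares linear forms, so on each chamber cut
  out by these comparisons the claim is a single numerical identity. The assumptions
  \<open>le\<close> select a representative of each orbit under the two swaps.\<close>

lemma balance_sorted:
  fixes a b c d :: int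
  assumes pos: "0 < a" "0 < b" "0 < c" "0 < d"
    and diag: "b = d \<Longrightarrow> d = 1" "c = d \<Longrightarrow> d = 1" "b = a \<Longrightarrow> a = 1" "c = a \<Longrightarrow> a = 1"
    and ne: "a \<noteq> b + c + d" and le: "d \<le> a" "b \<le> c" and ne1: "\<not> (a = 1 \<and> b = 1 \<and> c = 1 \<and> d = 1)"
  shows "balance a b c d + balance a c b d + balance d b c a + balance d c b a = 0"
proof (cases "a = d")
  case True
  have "balance a b c a = of_bool (c > a) - of_bool (a > b) - 3 + 2 * of_bool (a < b \<and> a < c)
        + 6 * of_bool (c < a) - 2 * of_bool (c < a \<and> b < a) + 5 * of_bool (b = a) - 2 * of_bool (b = a \<and> c = a)"
    if "0 < a" "0 < b" "0 < c" for a b c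
    using that by (simp add: balance_def)
  \<comment> \<open>For a = d the swap of the outer variables acts trivially, so the four terms are
    two terms counted twice.\<close>
  then have "balance a b c d + balance a c b d + balance d b c a + balance d c b a =
      2 * (of_bool (c > a) - of_bool (a > b) - 3 + 2 * of_bool (a < b \<and> a < c)
        + 6 * of_bool (c < a) - 2 * of_bool (c < a \<and> b < a) + 5 * of_bool (b = a) - 2 * of_bool (b = a \<and> c = a))
    + 2 * (of_bool (b > a) - of_bool (a > c) - 3 + 2 * of_bool (a < c \<and> a < b)
        + 6 * of_bool (b < a) - 2 * of_bool (b < a \<and> c < a) + 5 * of_bool (c = a) - 2 * of_bool (c = a \<and> b = a))"
    using pos True by simp
  moreover have "\<not> (b = a \<and> c \<le> a)"
    using True diag(1) ne1 pos le by auto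
  moreover have "c = a \<longrightarrow> b = a" using diag(4) le pos by auto
  ultimately show ?thesis
    using le by (cases "c < a"; cases "c = a"; cases "b < a"; cases "b = a") simp_all
next
  case False
  with le have lt: "d < a" by simp
  have neq: "a \<noteq> b" "a \<noteq> c" using lt diag pos by auto
  \<comment> \<open>Off the walls a = b, a = c and a = b + c + d, opposite strict comparisons are
    negations of each other. The walls b = d and c = d survive and stay as separate atoms.\<close>
  have gt: "(d < b) = (\<not> b < d \<and> b \<noteq> d)" "(d < c) = (\<not> c < d \<and> c \<noteq> d)"
     "(a < b) = (\<not> b < a)" "(a < c) = (\<not> c < a)" "(b + c + d < a) = (\<not> a - d < b + c)"
     "(2 * b \<le> a - d) = (\<not> a - d < 2 * b)" "(a - d < 2 * c) = (\<not> 2 * c \<le> a - d)"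
    using neq ne by auto
  have bc: "\<not> (2 * c \<le> a - d \<and> a - d < b + c)" "a - d < 2 * b \<and> a - d < 2 * c \<longleftrightarrow> a - d < 2 * b"
    "a < b \<and> a - d < 2 * c \<longleftrightarrow> a < b"
    using le pos by auto
  have 1: "balance a b c d = of_bool (d < c) - of_bool (b < a) - 2 * of_bool (b + c + d < a)
     - 2 * of_bool (a - d < 2 * b) - 2 * of_bool (a < b) + 2 * of_bool (d < b \<and> d < c)
     + 6 * of_bool (c < d) - 2 * of_bool (c < d \<and> b < d) + 5 * of_bool (b = d) - 2 * of_bool (b = d \<and> c = d)"
  proof -
    have e: "(d < a \<and> a - d < 2 * b \<and> a - d < 2 * c) = (a - d < 2 * b)" "(d < a \<and> a < b \<and> a - d < 2 * c) = (a < b)"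
      "(2 * c \<le> a - d \<and> a - d < b + c) = False" "(2 * c \<le> a - d \<and> a - d < b + c \<and> b < a) = False"
      "(d \<le> a \<and> d < b \<and> d < c) = (d < b \<and> d < c)" "(c < d \<and> d \<le> a) = (c < d)"
      "(c < d \<and> d \<le> a \<and> b < d) = (c < d \<and> b < d)" "(a = d) = False"
      using lt le pos by auto
    show ?thesis unfolding balance_def e of_bool_eq by simp
  qed
  have 2: "balance a c b d = of_bool (d < b) - of_bool (c < a) - 2 * of_bool (b + c + d < a)
     - 2 * of_bool (a - d < 2 * b) - 2 * of_bool (a < c \<and> a - d < 2 * b) + 2 * of_bool (d < b \<and> d < c)
     - 6 * of_bool (2 * b \<le> a - d \<and> a - d < b + c) + 6 * of_bool (b < d)
     + 2 * of_bool (2 * b \<le> a - d \<and> a - d < b + c \<and> c < a) - 2 * of_bool (c < d \<and> b < d)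
     + 5 * of_bool (c = d) - 2 * of_bool (b = d \<and> c = d)"
  proof -
    have e: "(d < a \<and> a - d < 2 * c \<and> a - d < 2 * b) = (a - d < 2 * b)" "(d < a \<and> a < c \<and> a - d < 2 * b) = (a < c \<and> a - d < 2 * b)"
      "(2 * b \<le> a - d \<and> a - d < c + b) = (2 * b \<le> a - d \<and> a - d < b + c)"
      "(2 * b \<le> a - d \<and> a - d < c + b \<and> c < a) = (2 * b \<le> a - d \<and> a - d < b + c \<and> c < a)"
      "(d \<le> a \<and> d < c \<and> d < b) = (d < b \<and> d < c)" "(b < d \<and> d \<le> a) = (b < d)"
      "(b < d \<and> d \<le> a \<and> c < d) = (c < d \<and> b < d)" "(a = d) = False" "(c = d \<and> b = d) = (b = d \<and> c = d)"
      "(c + b + d < a) = (b + c + d < a)"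
      using lt le pos by auto
    show ?thesis unfolding balance_def e of_bool_eq by simp
  qed
  have 3: "balance d b c a = of_bool (a < c) - of_bool (b < d)" "balance d c b a = of_bool (a < b) - of_bool (c < d)"
  proof -
    have e: "(a < d \<and> d - a < 2 * x \<and> d - a < 2 * y) = False" "(a < d \<and> d < x \<and> d - a < 2 * y) = False"
      "(a \<le> d \<and> a < x \<and> a < y) = False" "(x < a \<and> a \<le> d) = False" "(x < a \<and> a \<le> d \<and> y < a) = False"
      "(d = a) = False" "(b = a) = False" "(c = a) = False" for x y
      using lt neq by auto
    have e': "(2 * x \<le> d - a \<and> d - a < y) = False" "(2 * x \<le> d - a \<and> d - a < y \<and> z) = False" if "0 < x" for x y z
      using lt that by auto
    have e'': "(b + c + a < d) = False" "(c + b + a < d) = False"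
      using lt pos by auto
    show "balance d b c a = of_bool (a < c) - of_bool (b < d)" "balance d c b a = of_bool (a < b) - of_bool (c < d)"
      unfolding balance_def e e'[OF pos(2)] e'[OF pos(3)] e'' by simp_all
  qed
  have imps: "b < d \<longrightarrow> b \<noteq> d" "c < d \<longrightarrow> c \<noteq> d" "b = d \<and> c < d \<longrightarrow> False" "c < d \<longrightarrow> b < d" "c = d \<longrightarrow> b < d \<or> b = d"
    "b < d \<longrightarrow> b < a" "c < d \<longrightarrow> c < a" "b = d \<longrightarrow> b < a" "c = d \<longrightarrow> c < a"
    "c < a \<longrightarrow> b < a" "a - d < 2 * b \<longrightarrow> a - d < b + c" "\<not> b < a \<longrightarrow> a - d < 2 * b"
    "\<not> c < a \<longrightarrow> a - d < b + c" "c = d \<and> b < d \<longrightarrow> False"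
    using le lt pos diag by auto
  define p1 p2 p3 p4 q1 q2 r1 r2 where "p1 \<longleftrightarrow> b < d" "p2 \<longleftrightarrow> b = d" "p3 \<longleftrightarrow> c < d" "p4 \<longleftrightarrow> c = d"
    "q1 \<longleftrightarrow> b < a" "q2 \<longleftrightarrow> c < a" "r1 \<longleftrightarrow> a - d < 2 * b" "r2 \<longleftrightarrow> a - d < b + c" 
  note defs = this[symmetric]
  note imps = imps[unfolded defs]
  have r: "r1 \<longrightarrow> r2" "\<not> q1 \<longrightarrow> r1" "\<not> q2 \<longrightarrow> r2" using imps by blast+
  \<comment> \<open>The positions of b \<le> c relative to the thresholds d < a leave nine cases,
    since b < d = c would force d = 1 and b < 1. The atoms \<open>r1\<close> and \<open>r2\<close>
    remain free up to the implications \<open>r\<close>.\<close>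
  consider "p1" "\<not> p2" "p3" "\<not> p4" "q1" "q2" | "p1" "\<not> p2" "\<not> p3" "\<not> p4" "q1" "q2"
    | "p1" "\<not> p2" "\<not> p3" "\<not> p4" "q1" "\<not> q2" | "\<not> p1" "p2" "\<not> p3" "p4" "q1" "q2"
    | "\<not> p1" "p2" "\<not> p3" "\<not> p4" "q1" "q2" | "\<not> p1" "p2" "\<not> p3" "\<not> p4" "q1" "\<not> q2"
    | "\<not> p1" "\<not> p2" "\<not> p3" "\<not> p4" "q1" "q2" | "\<not> p1" "\<not> p2" "\<not> p3" "\<not> p4" "q1" "\<not> q2"
    | "\<not> p1" "\<not> p2" "\<not> p3" "\<not> p4" "\<not> q1" "\<not> q2"
    using imps by satx
  then show ?thesis
    unfolding 1 2 3 gt defs using r by cases (cases r1; cases r2; simp)+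
qed

lemma sum_sols_trichotomy:
  fixes u v :: "int \<Rightarrow> int \<Rightarrow> int \<Rightarrow> int \<Rightarrow> int" and f :: "int \<Rightarrow> int \<Rightarrow> int \<Rightarrow> int \<Rightarrow> real"
  shows "(\<Sum>(a, b, c, d)\<in>sols p (\<lambda>_ _ _ _. True). f a b c d) =
    (\<Sum>(a, b, c, d)\<in>sols p (\<lambda>a b c d. u a b c d < v a b c d). f a b c d) +
    ((\<Sum>(a, b, c, d)\<in>sols p (\<lambda>a b c d. u a b c d = v a b c d). f a b c d) +
    (\<Sum>(a, b, c, d)\<in>sols p (\<lambda>a b c d. v a b c d < u a b c d). f a b c d))"
  unfolding sum_sols_of_bool[of f p "\<lambda>a b c d. u a b c d < v a b c d"]
    sum_sols_of_bool[of f p "\<lambda>a b c d. u a b c d = v a b c d"]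
    sum_sols_of_bool[of f p "\<lambda>a b c d. v a b c d < u a b c d"]
  by (subst sum.distrib[symmetric])+ (rule sum.cong, auto)

lemma balance_symmetrised:
  assumes "prime p" "odd p" "(a, b, c, d) \<in> sols (int p) Q"
  shows "balance a b c d + balance a c b d + balance d b c a + balance d c b a = 0"
proof -
  have h: "0 < a" "0 < b" "0 < c" "0 < d" "a * d + b * c = int p"
    using assms(3) by (auto simp: sols_def)
  have ne: "\<not> (a = 1 \<and> b = 1 \<and> c = 1 \<and> d = 1)"
    using h assms(2) by auto
  note diag = sols_diag[OF assms(1,3)]
  have d5: "a \<noteq> c + b + d" "d \<noteq> b + c + a" "d \<noteq> c + b + a"
    using diag(5,6) by (simp_all add: ac_simps)
  consider "d \<le> a" "b \<le> c" | "d \<le> a" "c \<le> b" | "a \<le> d" "b \<le> c" | "a \<le> d" "c \<le> b"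
    by linarith
  then show ?thesis
  proof cases
    case 1
    then show ?thesis using balance_sorted[OF h(1,2,3,4) diag(1,2,3,4,5)] ne by blast
  next
    case 2
    then show ?thesis using balance_sorted[OF h(1,3,2,4) diag(2,1,4,3) d5(1)] ne by force
  next
    case 3
    then show ?thesis using balance_sorted[OF h(4,2,3,1) diag(3,4,1,2) d5(2)] ne by force
  next
    case 4
    then show ?thesis using balance_sorted[OF h(4,3,2,1) diag(4,3,2,1) d5(3)] ne by force
  qed
qed

lemma sum_balance:
  assumes "prime p" "odd p"
  shows "(\<Sum>(a, b, c, d)\<in>sols (int p) (\<lambda>_ _ _ _. True). of_int (balance a b c d) * \<phi> (a + d)) = (0 :: real)"
    (is "?S = 0")
proof -
  let ?A = "sols (int p) (\<lambda>_ _ _ _. True)"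
  have 1: "?S = (\<Sum>(a, b, c, d)\<in>?A. of_int (balance a c b d) * \<phi> (a + d))"
    by (rule sum.reindex_bij_witness[where i = "\<lambda>(a, b, c, d). (a, c, b, d)" and j = "\<lambda>(a, b, c, d). (a, c, b, d)"])
       (auto simp: sols_def algebra_simps)
  have 2: "?S = (\<Sum>(a, b, c, d)\<in>?A. of_int (balance d b c a) * \<phi> (a + d))"
    by (rule sum.reindex_bij_witness[where i = "\<lambda>(a, b, c, d). (d, b, c, a)" and j = "\<lambda>(a, b, c, d). (d, b, c, a)"])
       (auto simp: sols_def algebra_simps)
  have 3: "?S = (\<Sum>(a, b, c, d)\<in>?A. of_int (balance d c b a) * \<phi> (a + d))"
    by (rule sum.reindex_bij_witness[where i = "\<lambda>(a, b, c, d). (d, c, b, a)" and j = "\<lambda>(a, b, c, d). (d, c, b, a)"])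
       (auto simp: sols_def algebra_simps)
  have "4 * ?S = ?S + ?S + ?S + ?S" by simp
  also have "\<dots> = ?S + (\<Sum>(a, b, c, d)\<in>?A. of_int (balance a c b d) * \<phi> (a + d))
      + (\<Sum>(a, b, c, d)\<in>?A. of_int (balance d b c a) * \<phi> (a + d))
      + (\<Sum>(a, b, c, d)\<in>?A. of_int (balance d c b a) * \<phi> (a + d))"
    using 1 2 3 by linarith
  also have "\<dots> = (\<Sum>(a, b, c, d)\<in>?A.
      of_int (balance a b c d + balance a c b d + balance d b c a + balance d c b a) * \<phi> (a + d))"
    unfolding case_prod_unfold by (simp add: sum.distrib algebra_simps)
  also have "\<dots> = 0"
    by (rule sum.neutral) (auto simp: balance_symmetrised[OF assms] simp del: of_int_add)
  finally show ?thesis by simp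
qed

text \<open>The first three sums are the parts of the shifted sums with positive diagonal. The next
  two come from the class numbers: reduced matrices with positive diagonal, and forms with middle
  coefficient 0. The last two on the left cancel against \<open>dsum_relation\<close>. The
  right-hand side lives on walls.\<close>

lemma osum_relation:
  assumes "prime p" "odd p"
  shows "osum \<phi> (int p) (\<lambda>a b c d. c > d) - osum \<phi> (int p) (\<lambda>a b c d. a > b)
     - 2 * osum \<phi> (int p) (\<lambda>a b c d. a > b + c + d)
     - 2 * osum \<phi> (int p) (\<lambda>a b c d. d < a \<and> a - d < 2 * b \<and> a - d < 2 * c)
     - 3 * osum \<phi> (int p) (\<lambda>a b c d. a = d)
     - 2 * osum \<phi> (int p) (\<lambda>a b c d. d < a \<and> a < b \<and> a - d < 2 * c)
     + 2 * osum \<phi> (int p) (\<lambda>a b c d. d \<le> a \<and> d < b \<and> d < c)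
     = 2 * osum \<phi> (int p) (\<lambda>a b c d. b = d \<and> c = d) - 5 * osum \<phi> (int p) (\<lambda>a b c d. b = d)"
proof -
  let ?E = "osum \<phi> (int p)" and ?A = "sols (int p) (\<lambda>_ _ _ _. True)"
  have "?E (\<lambda>a b c d. c > d) - ?E (\<lambda>a b c d. a > b) - 2 * ?E (\<lambda>a b c d. a > b + c + d)
     - 2 * ?E (\<lambda>a b c d. d < a \<and> a - d < 2 * b \<and> a - d < 2 * c) - 3 * ?E (\<lambda>a b c d. a = d)
     - 2 * ?E (\<lambda>a b c d. d < a \<and> a < b \<and> a - d < 2 * c) + 2 * ?E (\<lambda>a b c d. d \<le> a \<and> d < b \<and> d < c)
     - 6 * ?E (\<lambda>a b c d. 2 * c \<le> a - d \<and> a - d < b + c) + 6 * ?E (\<lambda>a b c d. c < d \<and> d \<le> a)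
     + 2 * ?E (\<lambda>a b c d. 2 * c \<le> a - d \<and> a - d < b + c \<and> a > b) - 2 * ?E (\<lambda>a b c d. c < d \<and> d \<le> a \<and> b < d)
     + 5 * ?E (\<lambda>a b c d. b = d) - 2 * ?E (\<lambda>a b c d. b = d \<and> c = d)
    = (\<Sum>(a, b, c, d)\<in>?A. of_int (balance a b c d) * \<phi> (a + d))"
    unfolding osum_of_bool case_prod_unfold sum_distrib_left sum.distrib[symmetric] sum_subtractf[symmetric]
    by (rule sum.cong[OF refl], unfold balance_def) (simp only: of_int_add of_int_diff of_int_mult of_int_of_bool of_int_numeral algebra_simps)
  moreover have "?E (\<lambda>a b c d. 2 * c \<le> a - d \<and> a - d < b + c) = ?E (\<lambda>a b c d. c < d \<and> d \<le> a)"
    using osum_conj[of "\<lambda>_ _ _ _. True" "\<lambda>_ _ _ _. True" \<phi> "int p"] by simp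
  moreover have "?E (\<lambda>a b c d. 2 * c \<le> a - d \<and> a - d < b + c \<and> a > b) = ?E (\<lambda>a b c d. c < d \<and> d \<le> a \<and> b < d)"
    by (rule osum_conj) auto
  ultimately show ?thesis
    using sum_balance[OF assms, of \<phi>] by linarith
qed

lemma sols_diag_eq:
  assumes "prime p"
  shows "sols (int p) (\<lambda>a b c d. b = d) = (\<lambda>a. (a, 1, int p - a, 1)) ` {1..<int p}"
    and "sols (int p) (\<lambda>a b c d. b = a) = (\<lambda>d. (1, 1, int p - d, d)) ` {1..<int p}"
    and "sols (int p) (\<lambda>a b c d. c = d) = (\<lambda>a. (a, int p - a, 1, 1)) ` {1..<int p}"
    and "sols (int p) (\<lambda>a b c d. c = a) = (\<lambda>d. (1, int p - d, 1, d)) ` {1..<int p}"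
proof -
  have *: "sols (int p) Q = g ` {1..<int p}"
    if "\<And>a b c d. (a, b, c, d) \<in> sols (int p) Q \<Longrightarrow> (a, b, c, d) = g (h (a, b, c, d)) \<and> h (a, b, c, d) \<in> {1..<int p}"
      and "\<And>x. x \<in> {1..<int p} \<Longrightarrow> g x \<in> sols (int p) Q" for Q g and h :: "int \<times> int \<times> int \<times> int \<Rightarrow> int"
  proof (intro equalityI subsetI)
    fix t assume "t \<in> sols (int p) Q"
    then show "t \<in> g ` {1..<int p}"
      using that(1) by (cases t) (metis imageI)
  qed (use that(2) in blast)
  have D: "b = d \<and> d = 1 \<and> c = int p - a \<and> a \<in> {1..<int p}" if "(a, b, c, d) \<in> sols (int p) (\<lambda>a b c d. b = d)" for a b c d
  proof -
    have "d = 1" using sols_diag(1)[OF assms that] that by (simp add: sols_def)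
    then show ?thesis using that by (auto simp: sols_def)
  qed
  have D2: "b = a \<and> a = 1 \<and> c = int p - d \<and> d \<in> {1..<int p}" if "(a, b, c, d) \<in> sols (int p) (\<lambda>a b c d. b = a)" for a b c d
    using D[of d b c a] that by (auto simp: sols_def algebra_simps)
  have D3: "c = d \<and> d = 1 \<and> b = int p - a \<and> a \<in> {1..<int p}" if "(a, b, c, d) \<in> sols (int p) (\<lambda>a b c d. c = d)" for a b c d
    using D[of a c b d] that by (auto simp: sols_def algebra_simps)
  have D4: "c = a \<and> a = 1 \<and> b = int p - d \<and> d \<in> {1..<int p}" if "(a, b, c, d) \<in> sols (int p) (\<lambda>a b c d. c = a)" for a b c d
    using D[of d c b a] that by (auto simp: sols_def algebra_simps)
  show "sols (int p) (\<lambda>a b c d. b = d) = (\<lambda>a. (a, 1, int p - a, 1)) ` {1..<int p}"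
    by (rule *[where h = "\<lambda>(a, b, c, d). a"]) (use D in fastforce, auto simp: sols_def)
  show "sols (int p) (\<lambda>a b c d. b = a) = (\<lambda>d. (1, 1, int p - d, d)) ` {1..<int p}"
    by (rule *[where h = "\<lambda>(a, b, c, d). d"]) (use D2 in fastforce, auto simp: sols_def)
  show "sols (int p) (\<lambda>a b c d. c = d) = (\<lambda>a. (a, int p - a, 1, 1)) ` {1..<int p}"
    by (rule *[where h = "\<lambda>(a, b, c, d). a"]) (use D3 in fastforce, auto simp: sols_def)
  show "sols (int p) (\<lambda>a b c d. c = a) = (\<lambda>d. (1, int p - d, 1, d)) ` {1..<int p}"
    by (rule *[where h = "\<lambda>(a, b, c, d). d"]) (use D4 in fastforce, auto simp: sols_def)
qed

lemma osum_diag: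
  assumes "prime p"
  shows "osum \<phi> (int p) (\<lambda>a b c d. b = d) = (\<Sum>a = 1..<int p. \<phi> (a + 1))"
  unfolding osum_def sols_diag_eq[OF assms] by (subst sum.reindex) (auto simp: inj_on_def)

lemma osum_diag2:
  assumes "prime p" "odd p"
  shows "osum \<phi> (int p) (\<lambda>a b c d. b = d \<and> c = d) = \<phi> (int p)"
proof -
  have "p \<noteq> 2" using assms(2) by auto
  then have "2 < p" using prime_ge_2_nat[OF assms(1)] by simp
  have "sols (int p) (\<lambda>a b c d. b = d \<and> c = d) = sols (int p) (\<lambda>a b c d. b = d) \<inter> sols (int p) (\<lambda>a b c d. c = d)"
    by (auto simp: sols_def)
  also have "\<dots> = {(int p - 1, 1, 1, 1)}"
    unfolding sols_diag_eq[OF assms(1)] using \<open>2 < p\<close> by auto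
  finally show ?thesis by (simp add: osum_def)
qed

section \<open>Sums over shifted traces\<close>

definition outer_minus :: "(int \<Rightarrow> real) \<Rightarrow> int \<Rightarrow> real" where
  "outer_minus \<phi> p = (\<Sum>(a, b, c, d)\<in>sols p (\<lambda>_ _ _ _. True). \<phi> (a + d - b))"

text \<open>For M with rows (a, -b), (c, d) and U with rows (1, 0), (1, 1),
  \<open>outer_minus\<close> sums \<phi> over the traces of M U, and this sum uses the inverse of U
  instead.\<close>

definition outer_plus :: "(int \<Rightarrow> real) \<Rightarrow> int \<Rightarrow> real" where
  "outer_plus \<phi> p = (\<Sum>(a, b, c, d)\<in>sols p (\<lambda>_ _ _ _. True). \<phi> (a + d + b))"

text \<open>The solutions (a, b, c, -d) of the same equation in which the outer variables have opposite signs.\<close>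
definition dsols :: "int \<Rightarrow> (int \<Rightarrow> int \<Rightarrow> int \<Rightarrow> int \<Rightarrow> bool) \<Rightarrow> (int \<times> int \<times> int \<times> int) set" where
  "dsols p Q = {(a, b, c, d). 0 < a \<and> 0 < b \<and> 0 < c \<and> 0 < d \<and> b * c - a * d = p \<and> Q a b c d}"

definition dsum :: "(int \<Rightarrow> real) \<Rightarrow> int \<Rightarrow> (int \<Rightarrow> int \<Rightarrow> int \<Rightarrow> int \<Rightarrow> bool) \<Rightarrow> real" where
  "dsum \<phi> p Q = (\<Sum>(a, b, c, d)\<in>dsols p Q. \<phi> (a - d))"

text \<open>The map (a, b, c, d) -> (a - b, b, c + d, d) is M -> M U. Its first entry may be
  positive, zero or negative, which gives the three terms. In the negative case the diagonal is also
  swapped, so that the negative entry comes last, as in \<open>dsols\<close>.\<close>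

lemma outer_minus_eq:
  assumes "prime p"
  shows "outer_minus \<phi> (int p) = osum \<phi> (int p) (\<lambda>a b c d. c > d)
     + (\<Sum>r = 1..<int p. \<phi> r) + dsum \<phi> (int p) (\<lambda>a b c d. a < c \<and> d < b)"
proof -
  let ?f = "\<lambda>a b c d. \<phi> (a + d - b)"
  have 1: "(\<Sum>(a, b, c, d)\<in>sols (int p) (\<lambda>a b c d. b < a). ?f a b c d) = osum \<phi> (int p) (\<lambda>a b c d. c > d)"
    unfolding osum_def
    by (rule sum.reindex_bij_witness[where i = "\<lambda>(a, b, c, d). (a + b, b, c - d, d)" and j = "\<lambda>(a, b, c, d). (a - b, b, c + d, d)"])
       (auto simp: sols_def algebra_simps)
  have 2: "(\<Sum>(a, b, c, d)\<in>sols (int p) (\<lambda>a b c d. b = a). ?f a b c d) = (\<Sum>r = 1..<int p. \<phi> r)"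
    unfolding sols_diag_eq[OF assms] by (subst sum.reindex) (auto simp: inj_on_def)
  have 3: "(\<Sum>(a, b, c, d)\<in>sols (int p) (\<lambda>a b c d. a < b). ?f a b c d) = dsum \<phi> (int p) (\<lambda>a b c d. a < c \<and> d < b)"
    unfolding dsum_def
    by (rule sum.reindex_bij_witness[where i = "\<lambda>(a, b, c, d). (b - d, b, c - a, a)" and j = "\<lambda>(a, b, c, d). (d, b, c + d, b - a)"])
       (auto simp: sols_def dsols_def algebra_simps)
  have "outer_minus \<phi> (int p) =
      (\<Sum>(a, b, c, d)\<in>sols (int p) (\<lambda>a b c d. b < a). ?f a b c d) +
      ((\<Sum>(a, b, c, d)\<in>sols (int p) (\<lambda>a b c d. b = a). ?f a b c d) +
      (\<Sum>(a, b, c, d)\<in>sols (int p) (\<lambda>a b c d. a < b). ?f a b c d))"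
    unfolding outer_minus_def by (rule sum_sols_trichotomy)
  then show ?thesis using 1 2 3 by simp
qed

text \<open>Multiplication by the inverse of U gives the lower left entry c - d. For c < d, the
  regions c < a and a < c are both carried onto the same cone, hence the factor 2. On the walls c =
  d and c = a one always has a + b + d = p + 1; they contribute p - 1 and p - 2 points, their common
  point being counted once.\<close>

lemma outer_plus_eq:
  assumes "prime p"
  shows "outer_plus \<phi> (int p) = osum \<phi> (int p) (\<lambda>a b c d. a > b)
     + 2 * osum \<phi> (int p) (\<lambda>a b c d. a > b + c + d) + (2 * real p - 3) * \<phi> (int p + 1)"
proof -
  let ?f = "\<lambda>a b c d. \<phi> (a + d + b)"
  have p2: "2 \<le> p" using assms by (rule prime_ge_2_nat)
  have 1: "(\<Sum>(a, b, c, d)\<in>sols (int p) (\<lambda>a b c d. d < c). ?f a b c d) = osum \<phi> (int p) (\<lambda>a b c d. a > b)"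
    unfolding osum_def
    by (rule sum.reindex_bij_witness[where i = "\<lambda>(a, b, c, d). (a - b, b, c + d, d)" and j = "\<lambda>(a, b, c, d). (a + b, b, c - d, d)"])
       (auto simp: sols_def algebra_simps)
  have 2: "(\<Sum>(a, b, c, d)\<in>sols (int p) (\<lambda>a b c d. c = d). ?f a b c d) = (real p - 1) * \<phi> (int p + 1)"
  proof -
    have "(\<Sum>(a, b, c, d)\<in>sols (int p) (\<lambda>a b c d. c = d). ?f a b c d) = (\<Sum>a = 1..<int p. \<phi> (int p + 1))"
      unfolding sols_diag_eq(3)[OF assms] by (subst sum.reindex) (auto simp: inj_on_def add.commute)
    then show ?thesis using p2 by (simp add: of_nat_diff)
  qed
  have 3: "(\<Sum>(a, b, c, d)\<in>sols (int p) (\<lambda>a b c d. c < d \<and> c < a). ?f a b c d) = osum \<phi> (int p) (\<lambda>a b c d. a > b + c + d)"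
    unfolding osum_def
    by (rule sum.reindex_bij_witness[where i = "\<lambda>(a, b, c, d). (b + d, a - b - c - d, d, c + d)"
          and j = "\<lambda>(a, b, c, d). (a + d + b - c, a - c, d - c, c)"])
       (auto simp: sols_def algebra_simps)
  have 4: "(\<Sum>(a, b, c, d)\<in>sols (int p) (\<lambda>a b c d. c < d \<and> a < c). ?f a b c d) = osum \<phi> (int p) (\<lambda>a b c d. a > b + c + d)"
    unfolding osum_def
    by (rule sum.reindex_bij_witness[where i = "\<lambda>(a, b, c, d). (d, b, c + d, a - b)"
          and j = "\<lambda>(a, b, c, d). (d + b, b, c - a, a)"])
       (auto simp: sols_def algebra_simps)
  have "sols (int p) (\<lambda>a b c d. c < d \<and> c = a) = sols (int p) (\<lambda>a b c d. c = a) \<inter> {(a, b, c, d). c < d}"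
    by (auto simp: sols_def)
  also have "\<dots> = (\<lambda>d. (1, int p - d, 1, d)) ` {2..<int p}"
    unfolding sols_diag_eq(4)[OF assms] by auto
  finally have 5: "(\<Sum>(a, b, c, d)\<in>sols (int p) (\<lambda>a b c d. c < d \<and> c = a). ?f a b c d) = (real p - 2) * \<phi> (int p + 1)"
  proof -
    assume e: "sols (int p) (\<lambda>a b c d. c < d \<and> c = a) = (\<lambda>d. (1, int p - d, 1, d)) ` {2..<int p}"
    have "(\<Sum>(a, b, c, d)\<in>sols (int p) (\<lambda>a b c d. c < d \<and> c = a). ?f a b c d) = (\<Sum>a = 2..<int p. \<phi> (int p + 1))"
      unfolding e by (subst sum.reindex) (auto simp: inj_on_def add.commute)
    then show ?thesis using p2 by (simp add: of_nat_diff)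
  qed
  have "outer_plus \<phi> (int p) =
      (\<Sum>(a, b, c, d)\<in>sols (int p) (\<lambda>a b c d. d < c). ?f a b c d) +
      ((\<Sum>(a, b, c, d)\<in>sols (int p) (\<lambda>a b c d. d = c). ?f a b c d) +
      (\<Sum>(a, b, c, d)\<in>sols (int p) (\<lambda>a b c d. c < d). ?f a b c d))"
    unfolding outer_plus_def by (rule sum_sols_trichotomy)
  moreover have "sols (int p) (\<lambda>a b c d. d = c) = sols (int p) (\<lambda>a b c d. c = d)"
    by (auto simp: sols_def)
  moreover have "(\<Sum>(a, b, c, d)\<in>sols (int p) (\<lambda>a b c d. c < d). ?f a b c d) =
      (\<Sum>(a, b, c, d)\<in>sols (int p) (\<lambda>a b c d. c < d \<and> c < a). ?f a b c d) +
      (\<Sum>(a, b, c, d)\<in>sols (int p) (\<lambda>a b c d. c < d \<and> c = a). ?f a b c d) +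
      (\<Sum>(a, b, c, d)\<in>sols (int p) (\<lambda>a b c d. c < d \<and> a < c). ?f a b c d)"
    unfolding sum_sols_of_bool[of ?f "int p" "\<lambda>a b c d. c < d"] sum_sols_of_bool[of ?f "int p" "\<lambda>a b c d. c < d \<and> c < a"]
      sum_sols_of_bool[of ?f "int p" "\<lambda>a b c d. c < d \<and> c = a"] sum_sols_of_bool[of ?f "int p" "\<lambda>a b c d. c < d \<and> a < c"]
    by (subst sum.distrib[symmetric])+ (rule sum.cong, auto)
  ultimately show ?thesis using 1 2 3 4 5 by (simp add: algebra_simps)
qed

section \<open>Comparing regions with outer variables of opposite signs\<close>

text \<open>The indefinite equation b c - a d = p alone does not bound its solutions, so each region
  needs its own argument. Here integrality gives a d \<le> (c - 1) (b - 1), which leaves a linear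
  bound on b + c.\<close>

lemma finite_dsols_lt: "finite (dsols p (\<lambda>a b c d. a < c \<and> d < b))"
proof (rule finite_subset)
  show "dsols p (\<lambda>a b c d. a < c \<and> d < b) \<subseteq> {0..p} \<times> {0..p} \<times> {0..p} \<times> {0..p}"
  proof
    fix t assume "t \<in> dsols p (\<lambda>a b c d. a < c \<and> d < b)"
    then obtain a b c d where t: "t = (a, b, c, d)"
      and h: "0 < a" "0 < b" "0 < c" "0 < d" "b * c - a * d = p" "a < c" "d < b"
      by (cases t) (auto simp: dsols_def)
    have "a * d \<le> (c - 1) * (b - 1)" using h by (intro mult_mono) auto
    then have "b + c - 1 \<le> p" using h(5) by (simp add: algebra_simps)
    then show "t \<in> {0..p} \<times> {0..p} \<times> {0..p} \<times> {0..p}" using h t by simp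
  qed
qed simp

text \<open>The inequality of means gives 4 a d \<le> (a + d)^2, and integrality improves the two
  strict bounds on a + d by 1 each. The product 4 b c then cancels and a linear bound on b + c
  remains.\<close>

lemma finite_dsols_avg: "finite (dsols p (\<lambda>a b c d. a + d < 2 * b \<and> a + d < 2 * c))"
proof (rule finite_subset)
  show "dsols p (\<lambda>a b c d. a + d < 2 * b \<and> a + d < 2 * c) \<subseteq> {0..4*p} \<times> {0..4*p} \<times> {0..4*p} \<times> {0..4*p}"
  proof
    fix t assume "t \<in> dsols p (\<lambda>a b c d. a + d < 2 * b \<and> a + d < 2 * c)"
    then obtain a b c d where t: "t = (a, b, c, d)"
      and h: "0 < a" "0 < b" "0 < c" "0 < d" "b * c - a * d = p" "a + d < 2 * b" "a + d < 2 * c"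
      by (cases t) (auto simp: dsols_def)
    have "4 * (a * d) \<le> (a + d) * (a + d)"
      using zero_le_square[of "a - d"] by (simp add: algebra_simps)
    also have "\<dots> \<le> (2 * b - 1) * (2 * c - 1)" using h by (intro mult_mono) auto
    finally have "2 * b + 2 * c - 1 \<le> 4 * p" using h(5) by (simp add: algebra_simps)
    then show "t \<in> {0..4*p} \<times> {0..4*p} \<times> {0..4*p} \<times> {0..4*p}" using h t by simp
  qed
qed simp

lemma dsum_split:
  assumes "finite (dsols p Q)"
  shows "dsum \<phi> p Q = dsum \<phi> p (\<lambda>a b c d. Q a b c d \<and> R a b c d) + dsum \<phi> p (\<lambda>a b c d. Q a b c d \<and> \<not> R a b c d)"
proof -
  have "dsols p Q = dsols p (\<lambda>a b c d. Q a b c d \<and> R a b c d) \<union> dsols p (\<lambda>a b c d. Q a b c d \<and> \<not> R a b c d)"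
    by (auto simp: dsols_def)
  moreover have "finite (dsols p (\<lambda>a b c d. Q a b c d \<and> R a b c d))" "finite (dsols p (\<lambda>a b c d. Q a b c d \<and> \<not> R a b c d))"
    by (rule finite_subset[OF _ assms], force simp: dsols_def)+
  moreover have "dsols p (\<lambda>a b c d. Q a b c d \<and> R a b c d) \<inter> dsols p (\<lambda>a b c d. Q a b c d \<and> \<not> R a b c d) = {}"
    by (auto simp: dsols_def)
  ultimately show ?thesis unfolding dsum_def by (simp add: sum.union_disjoint)
qed

lemma dsum_cong: "(\<And>a b c d. 0 < a \<Longrightarrow> 0 < b \<Longrightarrow> 0 < c \<Longrightarrow> 0 < d \<Longrightarrow> b * c - a * d = p \<Longrightarrow> Q a b c d \<longleftrightarrow> R a b c d) \<Longrightarrow> dsum \<phi> p Q = dsum \<phi> p R"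
  unfolding dsum_def dsols_def by (rule sum.cong) auto

lemma dsum_swap:
  assumes "\<And>r. \<phi> (- r) = \<phi> r"
  shows "dsum \<phi> p Q = dsum \<phi> p (\<lambda>a b c d. Q d c b a)"
proof -
  have "\<phi> (a - d) = \<phi> (d - a)" for a d using assms[of "a - d"] by simp
  then show ?thesis
    unfolding dsum_def
    by (intro sum.reindex_bij_witness[where i = "\<lambda>(a, b, c, d). (d, c, b, a)" and j = "\<lambda>(a, b, c, d). (d, c, b, a)"])
       (auto simp: dsols_def algebra_simps)
qed

text \<open>Region \<open>?G\<close> stems from the reduced matrices, region \<open>?L\<close> from
  M -> M U. Each of the two set differences consists of two mirror halves under reversing (a, b, c,
  d), and unipotent conjugation, followed where necessary by a sign change of the trace, carries a
  half to one of the auxiliary cones of \<open>osum_relation\<close>.\<close>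

lemma dsum_relation:
  assumes "prime p" and even: "\<And>r. \<phi> (- r) = \<phi> r"
  shows "dsum \<phi> (int p) (\<lambda>a b c d. a + d < 2 * b \<and> a + d < 2 * c)
       + 2 * osum \<phi> (int p) (\<lambda>a b c d. d \<le> a \<and> d < b \<and> d < c)
     = dsum \<phi> (int p) (\<lambda>a b c d. a < c \<and> d < b) + 2 * \<phi> 1
       + 2 * osum \<phi> (int p) (\<lambda>a b c d. d < a \<and> a < b \<and> a - d < 2 * c)"
proof -
  let ?G = "\<lambda>a b c d. a + d < 2 * b \<and> a + d < 2 * c" and ?L = "\<lambda>a b c d. a < c \<and> d < (b :: int)"
  let ?D = "dsum \<phi> (int p)"
  have sub: "finite (dsols q (\<lambda>a b c d. Q a b c d \<and> R a b c d))" if "finite (dsols q Q)" for q Q R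
    by (rule finite_subset[OF _ that]) (auto simp: dsols_def)
  have even': "\<phi> (a - d) = \<phi> (d - a)" for a d using even[of "a - d"] by simp
  have 1: "?D (\<lambda>a b c d. ?G a b c d \<and> b < d) = osum \<phi> (int p) (\<lambda>a b c d. d < a \<and> a < b \<and> a - d < 2 * c)"
    unfolding osum_def dsum_def
    by (rule sum.reindex_bij_witness[where i = "\<lambda>(a, b, c, d). (b - a, b, c + b - a + d, d + b)"
          and j = "\<lambda>(a, b, c, d). (b - a, b, c - a - d + b, d - b)"])
       (auto simp: sols_def dsols_def algebra_simps even')
  have 2: "?D (\<lambda>a b c d. ?L a b c d \<and> 2 * b \<le> a + d) = osum \<phi> (int p) (\<lambda>a b c d. d \<le> a \<and> d < b \<and> d < c)"
    unfolding osum_def dsum_def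
    by (rule sum.reindex_bij_witness[where i = "\<lambda>(a, b, c, d). (a + b, b, c + b - d + a, b - d)"
          and j = "\<lambda>(a, b, c, d). (a - b, b, c - d - a + b, b - d)"])
       (auto simp: sols_def dsols_def algebra_simps)
  \<comment> \<open>On the wall b = d the equation reads (c - a) b = p with b > 1, so c - a = 1 and
    b = p; the inequalities then pin down a. The trace of this point is -1.\<close>
  have "dsols (int p) (\<lambda>a b c d. ?G a b c d \<and> b = d) = {(int p - 1, int p, int p, int p)}"
  proof (intro equalityI subsetI)
    fix t assume "t \<in> dsols (int p) (\<lambda>a b c d. ?G a b c d \<and> b = d)"
    then obtain a b c where t: "t = (a, b, c, b)" and h: "0 < a" "0 < b" "0 < c" "b * c - a * b = int p" "a < b" "a + b < 2 * c"
      by (cases t) (auto simp: dsols_def)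
    have e: "(c - a) * b = int p" using h(4) by (simp add: algebra_simps)
    moreover have "0 < c - a" using h e prime_gt_0_nat[OF assms(1)]
      by (metis of_nat_0_less_iff zero_less_mult_pos2)
    ultimately have "c - a = 1" using prime_factor_one[OF assms(1) e] h by auto
    then show "t \<in> {(int p - 1, int p, int p, int p)}" using e h t by auto
  qed (use prime_ge_2_nat[OF assms(1)] in \<open>auto simp: dsols_def algebra_simps\<close>)
  then have 3: "?D (\<lambda>a b c d. ?G a b c d \<and> b = d) = \<phi> 1"
    using even[of 1] by (simp add: dsum_def)
  have G: "?D ?G = ?D (\<lambda>a b c d. ?G a b c d \<and> ?L a b c d) + ?D (\<lambda>a b c d. ?G a b c d \<and> \<not> ?L a b c d)"
    by (rule dsum_split[OF finite_dsols_avg])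
  have L: "?D ?L = ?D (\<lambda>a b c d. ?L a b c d \<and> ?G a b c d) + ?D (\<lambda>a b c d. ?L a b c d \<and> \<not> ?G a b c d)"
    by (rule dsum_split[OF finite_dsols_lt])
  \<comment> \<open>Outside \<open>?L\<close> either b \<le> d or c \<le> a, and never both, because
    b c > a d.\<close>
  have "?D (\<lambda>a b c d. ?G a b c d \<and> \<not> ?L a b c d) =
      ?D (\<lambda>a b c d. (?G a b c d \<and> \<not> ?L a b c d) \<and> b \<le> d) + ?D (\<lambda>a b c d. (?G a b c d \<and> \<not> ?L a b c d) \<and> \<not> b \<le> d)"
    by (rule dsum_split[OF sub[OF finite_dsols_avg]])
  also have "?D (\<lambda>a b c d. (?G a b c d \<and> \<not> ?L a b c d) \<and> b \<le> d) = ?D (\<lambda>a b c d. ?G a b c d \<and> b \<le> d)"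
    by (rule dsum_cong) auto
  also have "?D (\<lambda>a b c d. (?G a b c d \<and> \<not> ?L a b c d) \<and> \<not> b \<le> d) = ?D (\<lambda>a b c d. ?G d c b a \<and> c \<le> a)"
    by (rule dsum_cong) auto
  also have "\<dots> = ?D (\<lambda>a b c d. ?G a b c d \<and> b \<le> d)"
    by (rule dsum_swap[of \<phi>, OF even, symmetric])
  also have "?D (\<lambda>a b c d. ?G a b c d \<and> b \<le> d) =
      ?D (\<lambda>a b c d. (?G a b c d \<and> b \<le> d) \<and> b = d) + ?D (\<lambda>a b c d. (?G a b c d \<and> b \<le> d) \<and> b \<noteq> d)"
    by (rule dsum_split[OF sub[OF finite_dsols_avg]])
  also have "?D (\<lambda>a b c d. (?G a b c d \<and> b \<le> d) \<and> b = d) = ?D (\<lambda>a b c d. ?G a b c d \<and> b = d)"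
    by (rule dsum_cong) auto
  also have "?D (\<lambda>a b c d. (?G a b c d \<and> b \<le> d) \<and> b \<noteq> d) = ?D (\<lambda>a b c d. ?G a b c d \<and> b < d)"
    by (rule dsum_cong) auto
  finally have GL: "?D (\<lambda>a b c d. ?G a b c d \<and> \<not> ?L a b c d) = 2 * \<phi> 1
       + 2 * osum \<phi> (int p) (\<lambda>a b c d. d < a \<and> a < b \<and> a - d < 2 * c)"
    using 1 3 by simp
  \<comment> \<open>Inside \<open>?L\<close> the inequalities 2 b \<le> a + d and 2 c \<le> a + d
    exclude each other, since together they give b + c \<le> a + d.\<close>
  have "?D (\<lambda>a b c d. ?L a b c d \<and> \<not> ?G a b c d) =
      ?D (\<lambda>a b c d. (?L a b c d \<and> \<not> ?G a b c d) \<and> 2 * b \<le> a + d) + ?D (\<lambda>a b c d. (?L a b c d \<and> \<not> ?G a b c d) \<and> \<not> 2 * b \<le> a + d)"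
    by (rule dsum_split[OF sub[OF finite_dsols_lt]])
  also have "?D (\<lambda>a b c d. (?L a b c d \<and> \<not> ?G a b c d) \<and> 2 * b \<le> a + d) = ?D (\<lambda>a b c d. ?L a b c d \<and> 2 * b \<le> a + d)"
    by (rule dsum_cong) auto
  also have "?D (\<lambda>a b c d. (?L a b c d \<and> \<not> ?G a b c d) \<and> \<not> 2 * b \<le> a + d) = ?D (\<lambda>a b c d. ?L d c b a \<and> 2 * c \<le> d + a)"
    by (rule dsum_cong) auto
  also have "\<dots> = ?D (\<lambda>a b c d. ?L a b c d \<and> 2 * b \<le> a + d)"
    by (rule dsum_swap[of \<phi>, OF even, symmetric])
  finally have LG: "?D (\<lambda>a b c d. ?L a b c d \<and> \<not> ?G a b c d) = 2 * osum \<phi> (int p) (\<lambda>a b c d. d \<le> a \<and> d < b \<and> d < c)"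
    using 2 by simp
  have "?D (\<lambda>a b c d. ?L a b c d \<and> ?G a b c d) = ?D (\<lambda>a b c d. ?G a b c d \<and> ?L a b c d)"
    by (rule dsum_cong) auto
  then show ?thesis using G L GL LG by linarith
qed

section \<open>Liouville's identity and the character modulo 4\<close>

lemma sum_shift_one:
  fixes \<phi> :: "int \<Rightarrow> real"
  assumes "1 \<le> p" shows "(\<Sum>r = 1..<p. \<phi> (r + 1)) = (\<Sum>r = 1..<p. \<phi> r) - \<phi> 1 + \<phi> p"
proof -
  have "(\<Sum>r = 1..<p. \<phi> (r + 1)) = (\<Sum>r = 2..<p + 1. \<phi> r)"
    by (rule sum.reindex_bij_witness[where i = "\<lambda>r. r - 1" and j = "\<lambda>r. r + 1"]) auto
  moreover have "(\<Sum>r = 1..<p + 1. \<phi> r) = \<phi> 1 + (\<Sum>r = 2..<p + 1. \<phi> r)"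
  proof -
    have "{1..<p + 1} = insert 1 {2..<p + 1}" using assms by auto
    then show ?thesis by simp
  qed
  moreover have "(\<Sum>r = 1..<p + 1. \<phi> r) = \<phi> p + (\<Sum>r = 1..<p. \<phi> r)"
  proof -
    have "{1..<p + 1} = insert p {1..<p}" using assms by auto
    then show ?thesis by simp
  qed
  ultimately show ?thesis by simp
qed

text \<open>The left-hand side is arranged as the count of Selling triples plus 3/2 times the count
  of diagonal forms, weighted by \<phi>. The two auxiliary cones and the \<open>dsum\<close> coming
  from M U cancel in the linear combination.\<close>

lemma trace_relation:
  assumes "prime p" "odd p" and even: "\<And>r. \<phi> (- r) = \<phi> r"
  shows "2 * osum \<phi> (int p) (\<lambda>a b c d. d < a \<and> a - d < 2 * b \<and> a - d < 2 * c)
      + dsum \<phi> (int p) (\<lambda>a b c d. a + d < 2 * b \<and> a + d < 2 * c) + 4 * \<phi> 1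
      + 3 * osum \<phi> (int p) (\<lambda>a b c d. a = d) + 3 * \<phi> 0
    = outer_minus \<phi> (int p) - outer_plus \<phi> (int p) + 3 * \<phi> 0 + \<phi> 1 + 3 * \<phi> (int p)
      + 4 * (\<Sum>r = 1..<int p. \<phi> r) + (2 * real p - 3) * \<phi> (int p + 1)"
  using osum_relation[OF assms(1,2), of \<phi>] dsum_relation[OF assms(1), of \<phi>, OF even]
    outer_minus_eq[OF assms(1), of \<phi>] outer_plus_eq[OF assms(1), of \<phi>]
    osum_diag[OF assms(1), of \<phi>] osum_diag2[OF assms(1,2), of \<phi>]
    sum_shift_one[of "int p" \<phi>] prime_ge_1_nat[OF assms(1)]
  by simp

text \<open>Liouville's identity with only the divisors 1 and p. Subtracting one column of the
  matrix from the other turns both F (a - b) and F (a + b) into F a on half of the solutions;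
  evenness of F and a symmetry handle the other half.\<close>

lemma liouville_prime:
  fixes F :: "int \<Rightarrow> real"
  assumes "prime p" and even: "\<And>r. F (- r) = F r"
  shows "(\<Sum>(a, b, c, d)\<in>sols (int p) (\<lambda>_ _ _ _. True). F (a - b) - F (a + b)) =
    (real p - 1) * (F 0 + 2 * F 1 - F (int p)) - 2 * (\<Sum>r = 1..<int p. F r)"
proof -
  let ?A = "sols (int p)" and ?T = "\<lambda>_ _ _ _. True"
  have p1: "1 \<le> p" using assms(1) by (rule prime_ge_1_nat)
  have even': "F (a - b) = F (b - a)" for a b using even[of "a - b"] by simp
  have m1: "(\<Sum>(a, b, c, d)\<in>?A (\<lambda>a b c d. b < a). F (a - b)) = (\<Sum>(a, b, c, d)\<in>?A (\<lambda>a b c d. d < c). F a)"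
    by (rule sum.reindex_bij_witness[where i = "\<lambda>(a, b, c, d). (a + b, b, c - d, d)" and j = "\<lambda>(a, b, c, d). (a - b, b, c + d, d)"])
       (auto simp: sols_def algebra_simps)
  have m2: "(\<Sum>(a, b, c, d)\<in>?A (\<lambda>a b c d. a < b). F (a - b)) = (\<Sum>(a, b, c, d)\<in>?A (\<lambda>a b c d. b < a). F (a - b))"
    by (rule sum.reindex_bij_witness[where i = "\<lambda>(a, b, c, d). (b, a, d, c)" and j = "\<lambda>(a, b, c, d). (b, a, d, c)"])
       (auto simp: sols_def algebra_simps even')
  have m3: "(\<Sum>(a, b, c, d)\<in>?A (\<lambda>a b c d. b = a). F (a - b)) = (real p - 1) * F 0"
    unfolding sols_diag_eq[OF assms(1)] using p1 by (subst sum.reindex) (auto simp: inj_on_def of_nat_diff)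
  have q1: "(\<Sum>(a, b, c, d)\<in>?A (\<lambda>a b c d. c < d). F (a + b)) = (\<Sum>(a, b, c, d)\<in>?A (\<lambda>a b c d. b < a). F a)"
    by (rule sum.reindex_bij_witness[where i = "\<lambda>(a, b, c, d). (b, a - b, d, c + d)" and j = "\<lambda>(a, b, c, d). (a + b, a, d - c, c)"])
       (auto simp: sols_def algebra_simps)
  have q2: "(\<Sum>(a, b, c, d)\<in>?A (\<lambda>a b c d. d < c). F (a + b)) = (\<Sum>(a, b, c, d)\<in>?A (\<lambda>a b c d. c < d). F (a + b))"
    by (rule sum.reindex_bij_witness[where i = "\<lambda>(a, b, c, d). (b, a, d, c)" and j = "\<lambda>(a, b, c, d). (b, a, d, c)"])
       (auto simp: sols_def algebra_simps)
  have q3: "(\<Sum>(a, b, c, d)\<in>?A (\<lambda>a b c d. c = d). F (a + b)) = (real p - 1) * F (int p)"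
    unfolding sols_diag_eq[OF assms(1)] using p1 by (subst sum.reindex) (auto simp: inj_on_def of_nat_diff)
  have r1: "(\<Sum>(a, b, c, d)\<in>?A (\<lambda>a b c d. c < d). F a) = (\<Sum>(a, b, c, d)\<in>?A (\<lambda>a b c d. a < b). F a)"
    by (rule sum.reindex_bij_witness[where i = "\<lambda>(a, b, c, d). (a, b - a, c, d + c)" and j = "\<lambda>(a, b, c, d). (a, a + b, c, d - c)"])
       (auto simp: sols_def algebra_simps)
  have r2: "(\<Sum>(a, b, c, d)\<in>?A (\<lambda>a b c d. c = d). F a) = (\<Sum>r = 1..<int p. F r)"
    unfolding sols_diag_eq[OF assms(1)] by (subst sum.reindex) (auto simp: inj_on_def)
  have r3: "(\<Sum>(a, b, c, d)\<in>?A (\<lambda>a b c d. b = a). F a) = (real p - 1) * F 1"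
    unfolding sols_diag_eq[OF assms(1)] using p1 by (subst sum.reindex) (auto simp: inj_on_def of_nat_diff)
  have "(\<Sum>(a, b, c, d)\<in>?A ?T. F (a - b)) =
      2 * (\<Sum>(a, b, c, d)\<in>?A (\<lambda>a b c d. d < c). F a) + (real p - 1) * F 0"
    using sum_sols_trichotomy[where p = "int p" and f = "\<lambda>a b c d. F (a - b)" and u = "\<lambda>a b c d. b" and v = "\<lambda>a b c d. a"] m1 m2 m3 by simp
  moreover have "(\<Sum>(a, b, c, d)\<in>?A ?T. F (a + b)) =
      2 * (\<Sum>(a, b, c, d)\<in>?A (\<lambda>a b c d. b < a). F a) + (real p - 1) * F (int p)"
    using sum_sols_trichotomy[where p = "int p" and f = "\<lambda>a b c d. F (a + b)" and u = "\<lambda>a b c d. c" and v = "\<lambda>a b c d. d"] q1 q2 q3 by simp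
  \<comment> \<open>The total sum of F a is split once by comparing c with d and once by comparing a
    with b. By \<open>r1\<close> the parts c < d and a < b agree, so the remaining halves differ
    only by wall terms.\<close>
  moreover have "(\<Sum>(a, b, c, d)\<in>?A (\<lambda>a b c d. d < c). F a) =
      (\<Sum>(a, b, c, d)\<in>?A (\<lambda>a b c d. b < a). F a) + (real p - 1) * F 1 - (\<Sum>r = 1..<int p. F r)"
    using sum_sols_trichotomy[where p = "int p" and f = "\<lambda>a b c d. F a" and u = "\<lambda>a b c d. b" and v = "\<lambda>a b c d. a"]
      sum_sols_trichotomy[where p = "int p" and f = "\<lambda>a b c d. F a" and u = "\<lambda>a b c d. c" and v = "\<lambda>a b c d. d"] r1 r2 r3 by simp
  moreover have "(\<Sum>(a, b, c, d)\<in>?A ?T. F (a - b) - F (a + b)) =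
      (\<Sum>(a, b, c, d)\<in>?A ?T. F (a - b)) - (\<Sum>(a, b, c, d)\<in>?A ?T. F (a + b))"
    unfolding case_prod_unfold by (rule sum_subtractf)
  ultimately show ?thesis by (simp add: algebra_simps)
qed

text \<open>The values of the cosine and the sine at \<pi> r / 2.\<close>
definition c4 :: "int \<Rightarrow> real" where
  "c4 r = (if r mod 4 = 0 then 1 else if r mod 4 = 2 then - 1 else 0)"

definition s4 :: "int \<Rightarrow> real" where
  "s4 r = (if r mod 4 = 1 then 1 else if r mod 4 = 3 then - 1 else 0)"

lemma mod4_cases:
  fixes r :: int
  obtains "r mod 4 = 0" | "r mod 4 = 1" | "r mod 4 = 2" | "r mod 4 = 3"
proof -
  have "r mod 4 = 0 \<or> r mod 4 = 1 \<or> r mod 4 = 2 \<or> r mod 4 = 3" by presburger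
  then show thesis using that by (elim disjE) simp_all
qed

lemma odd_mod4: "odd (r :: int) \<longleftrightarrow> r mod 4 = 1 \<or> r mod 4 = 3"
  and even_mod4: "even (r :: int) \<longleftrightarrow> r mod 4 = 0 \<or> r mod 4 = 2"
  by presburger+

text \<open>Besides satisfying the addition formulas, s4 is the nontrivial Dirichlet character
  modulo 4, hence multiplicative. An odd factor y is 1 or -1 modulo 4, and the cosine is
  even.\<close>

lemma c4_add: "c4 (x + y) = c4 x * c4 y - s4 x * s4 y"
  and s4_add: "s4 (x + y) = s4 x * c4 y + c4 x * s4 y"
  and s4_mult: "s4 (x * y) = s4 x * s4 y"
  and c4_mult_odd: "odd y \<Longrightarrow> c4 (x * y) = c4 x"
proof -
  have "(x + y) mod 4 = (x mod 4 + y mod 4) mod 4" "(x * y) mod 4 = (x mod 4 * (y mod 4)) mod 4"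
    by (simp_all add: mod_add_eq mod_mult_eq)
  note e = this
  show "c4 (x + y) = c4 x * c4 y - s4 x * s4 y"
    by (cases rule: mod4_cases[of x]; cases rule: mod4_cases[of y]; simp add: c4_def s4_def e)
  show "s4 (x + y) = s4 x * c4 y + c4 x * s4 y"
    by (cases rule: mod4_cases[of x]; cases rule: mod4_cases[of y]; simp add: c4_def s4_def e)
  show "s4 (x * y) = s4 x * s4 y"
    by (cases rule: mod4_cases[of x]; cases rule: mod4_cases[of y]; simp add: c4_def s4_def e)
  assume "odd y"
  then have "y mod 4 = 1 \<or> y mod 4 = 3" by (simp add: odd_mod4)
  then show "c4 (x * y) = c4 x"
    by (cases rule: mod4_cases[of x]) (auto simp: c4_def e)
qed

lemma c4_minus: "c4 (- x) = c4 x" and s4_minus: "s4 (- x) = - s4 x"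
proof -
  have "(- x) mod 4 = (- (x mod 4)) mod 4" by (simp add: mod_minus_eq)
  note e = this
  show "c4 (- x) = c4 x" "s4 (- x) = - s4 x"
    by (cases rule: mod4_cases[of x]; simp add: c4_def s4_def e)+
qed

lemma c4_diff: "c4 (x - y) = c4 x * c4 y + s4 x * s4 y"
  and s4_diff: "s4 (x - y) = s4 x * c4 y - c4 x * s4 y"
  using c4_add[of x "- y"] s4_add[of x "- y"] by (simp_all add: c4_minus s4_minus)

lemma c4_odd [simp]: "odd r \<Longrightarrow> c4 r = 0" and s4_even [simp]: "even r \<Longrightarrow> s4 r = 0"
  and s4_odd_sq: "odd r \<Longrightarrow> s4 r * s4 r = 1"
  unfolding c4_def s4_def even_mod4 by auto

lemma sum_c4:
  "(\<Sum>r = 1..<int n. c4 r) = (if n mod 4 = 1 \<or> n mod 4 = 2 \<or> n = 0 then 0 else - 1)"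
proof (induction n)
  case (Suc n)
  show ?case
  proof (cases "n = 0")
    case False
    then have "{1..<int (Suc n)} = insert (int n) {1..<int n}" by auto
    then have *: "(\<Sum>r = 1..<int (Suc n). c4 r) = c4 (int n) + (\<Sum>r = 1..<int n. c4 r)" by simp
    have "n mod 4 = 0 \<or> n mod 4 = 1 \<or> n mod 4 = 2 \<or> n mod 4 = 3" by presburger
    moreover have "int n mod 4 = int (n mod 4)" by (simp add: zmod_int)
    moreover have "Suc n mod 4 = (Suc (n mod 4)) mod 4" by (simp add: mod_Suc_eq)
    ultimately show ?thesis unfolding * Suc using False
      by (auto simp: c4_def)
  qed simp
qed simp

text \<open>For a even and d odd, b c = p - a d is odd and the character gives s4 b s4 c = s4 p c4
  a, because c4 p = 0. This trades the cosine of a and the sine of b for a parity condition and the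
  sine of c.\<close>

lemma s4_c4_rearrange:
  assumes "odd p" "(a, b, c, d) \<in> sols p Q"
  shows "c4 a * s4 d * s4 b = s4 p * (of_bool (even a) * s4 c * s4 d)"
proof (cases "even a \<and> odd d")
  case True
  have h: "a * d + b * c = p" using assms by (auto simp: sols_def)
  with True assms(1) have bc: "odd b" "odd c" by auto
  have "s4 b * s4 c = s4 (p - a * d)" using h s4_mult[of b c] by (simp add: algebra_simps flip: h)
  also have "\<dots> = s4 p * c4 a" using True assms(1) by (simp add: s4_diff c4_mult_odd)
  finally have "s4 b * (s4 c * s4 c) = s4 p * c4 a * s4 c" by (metis mult.assoc)
  then have "s4 b = s4 p * c4 a * s4 c" using s4_odd_sq[OF bc(2)] by simp
  then have "c4 a * s4 d * s4 b = (c4 a * c4 a) * (s4 p * (s4 c * s4 d))" by simp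
  moreover have "c4 a * c4 a = 1" using True by (auto simp: c4_def even_mod4)
  ultimately show ?thesis using True by simp
qed auto

text \<open>The addition formulas give c4 (x - b) - c4 (x + b) = 2 s4 x s4 b with x = a + d. The
  rearrangement above reduces this to the sum of s4 c s4 d, which Liouville's identity
  evaluates.\<close>

lemma outer_c4:
  assumes "prime p" "odd p"
  shows "outer_minus c4 (int p) - outer_plus c4 (int p) = real p * s4 (int p) - 1"
proof -
  let ?A = "sols (int p) (\<lambda>_ _ _ _. True)"
  have oddp: "odd (int p)" using assms(2) by simp
  have "outer_minus c4 (int p) - outer_plus c4 (int p) =
      (\<Sum>(a, b, c, d)\<in>?A. 2 * (s4 a * c4 d * s4 b) + 2 * (c4 a * s4 d * s4 b))"
    unfolding outer_minus_def outer_plus_def case_prod_unfold sum_subtractf[symmetric]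
    by (rule sum.cong) (simp_all add: c4_add c4_diff s4_add algebra_simps)
  also have "\<dots> = 2 * (\<Sum>(a, b, c, d)\<in>?A. s4 a * c4 d * s4 b) + 2 * (\<Sum>(a, b, c, d)\<in>?A. c4 a * s4 d * s4 b)"
    unfolding case_prod_unfold by (simp add: sum.distrib sum_distrib_left)
  also have "(\<Sum>(a, b, c, d)\<in>?A. s4 a * c4 d * s4 b) = (\<Sum>(a, b, c, d)\<in>?A. c4 a * s4 d * s4 b)"
    by (rule sum.reindex_bij_witness[where i = "\<lambda>(a, b, c, d). (d, b, c, a)" and j = "\<lambda>(a, b, c, d). (d, b, c, a)"])
       (auto simp: sols_def algebra_simps)
  also have "(\<Sum>(a, b, c, d)\<in>?A. c4 a * s4 d * s4 b) = s4 (int p) * (\<Sum>(a, b, c, d)\<in>?A. of_bool (even a) * s4 c * s4 d)"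
    unfolding sum_distrib_left by (rule sum.cong) (auto simp: s4_c4_rearrange[OF oddp])
  also have "2 * (s4 (int p) * (\<Sum>(a, b, c, d)\<in>?A. of_bool (even a) * s4 c * s4 d)) +
      2 * (s4 (int p) * (\<Sum>(a, b, c, d)\<in>?A. of_bool (even a) * s4 c * s4 d)) =
      2 * s4 (int p) * (2 * (\<Sum>(a, b, c, d)\<in>?A. of_bool (even a) * s4 c * s4 d))" by simp
  \<comment> \<open>Only odd c and d contribute. As p is odd, exactly one of a and b is then even,
    so the parity condition selects half of the sum by symmetry.\<close>
  also have "2 * (\<Sum>(a, b, c, d)\<in>?A. of_bool (even a) * s4 c * s4 d) = (\<Sum>(a, b, c, d)\<in>?A. s4 c * s4 d)"
  proof -
    have "(\<Sum>(a, b, c, d)\<in>?A. of_bool (even a) * s4 c * s4 d) = (\<Sum>(a, b, c, d)\<in>?A. of_bool (even b) * s4 c * s4 d)"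
      by (rule sum.reindex_bij_witness[where i = "\<lambda>(a, b, c, d). (b, a, d, c)" and j = "\<lambda>(a, b, c, d). (b, a, d, c)"])
         (auto simp: sols_def algebra_simps)
    moreover have "of_bool (even a) * s4 c * s4 d + of_bool (even b) * s4 c * s4 d = s4 c * s4 d"
      if "(a, b, c, d) \<in> ?A" for a b c d
    proof (cases "odd c \<and> odd d")
      case True
      have "a * d + b * c = int p" using that by (simp add: sols_def)
      then have "odd (a * d + b * c)" using oddp by simp
      then have "even a \<longleftrightarrow> odd b" using True by simp
      then show ?thesis by simp
    qed auto
    then have "(\<Sum>(a, b, c, d)\<in>?A. of_bool (even a) * s4 c * s4 d) + (\<Sum>(a, b, c, d)\<in>?A. of_bool (even b) * s4 c * s4 d)
        = (\<Sum>(a, b, c, d)\<in>?A. s4 c * s4 d)"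
      by (subst sum.distrib[symmetric]) (rule sum.cong, auto)
    ultimately show ?thesis by linarith
  qed
  finally have "outer_minus c4 (int p) - outer_plus c4 (int p) =
     2 * s4 (int p) * (\<Sum>(a, b, c, d)\<in>?A. s4 c * s4 d)" by simp
  also have "\<dots> = s4 (int p) * (2 * (\<Sum>(a, b, c, d)\<in>?A. s4 c * s4 d))" by simp
  \<comment> \<open>Product formula 2 s4 x s4 y = c4 (x - y) - c4 (x + y), after moving the pair (c,
    d) to the front.\<close>
  also have "2 * (\<Sum>(a, b, c, d)\<in>?A. s4 c * s4 d) = (\<Sum>(a, b, c, d)\<in>?A. c4 (a - b) - c4 (a + b))"
    unfolding sum_distrib_left
    by (rule sum.reindex_bij_witness[where i = "\<lambda>(a, b, c, d). (d, c, b, a)" and j = "\<lambda>(a, b, c, d). (d, c, b, a)"])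
       (auto simp: sols_def algebra_simps c4_add c4_diff)
  also have "(\<Sum>(a, b, c, d)\<in>?A. c4 (a - b) - c4 (a + b)) = (real p - 1) - 2 * (\<Sum>r = 1..<int p. c4 r)"
  proof -
    have "c4 0 = 1" "c4 1 = 0" "c4 (int p) = 0" using oddp by (simp_all add: c4_def[of 0])
    then show ?thesis using liouville_prime[of p c4, OF assms(1) c4_minus] by simp
  qed
  finally have "outer_minus c4 (int p) - outer_plus c4 (int p) =
     s4 (int p) * ((real p - 1) - 2 * (\<Sum>r = 1..<int p. c4 r))" by (simp add: mult.assoc)
  moreover have "int p mod 4 = int (p mod 4)" "p mod 4 = 1 \<or> p mod 4 = 3"
    using assms(2) by (simp add: zmod_int, presburger)
  ultimately show ?thesis
    by (auto simp: sum_c4 s4_def)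
qed

section \<open>Selling reduction of binary quadratic forms\<close>

lemma bqf_subst_comp:
  "bqf_subst \<alpha>' \<beta>' \<gamma>' \<delta>' (bqf_subst \<alpha> \<beta> \<gamma> \<delta> f) =
   bqf_subst (\<alpha>*\<alpha>' + \<beta>*\<gamma>') (\<alpha>*\<beta>' + \<beta>*\<delta>') (\<gamma>*\<alpha>' + \<delta>*\<gamma>') (\<gamma>*\<beta>' + \<delta>*\<delta>') f"
  by (cases f) (simp add: algebra_simps power2_eq_square)

lemma equiv_sl2: "equiv UNIV sl2_equiv"
proof (rule equivI)
  show "sl2_equiv \<subseteq> UNIV \<times> UNIV" by simp
  show "refl sl2_equiv"
  proof (rule reflI)
    fix f :: bqf
    have "f = bqf_subst 1 0 0 1 f" by (cases f) simp
    then show "(f, f) \<in> sl2_equiv" unfolding sl2_equiv_def by force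
  qed
  show "sym sl2_equiv"
  proof (rule symI)
    fix f g assume "(f, g) \<in> sl2_equiv"
    then obtain \<alpha> \<beta> \<gamma> \<delta> where det: "\<alpha>*\<delta> - \<beta>*\<gamma> = 1" and g: "g = bqf_subst \<alpha> \<beta> \<gamma> \<delta> f"
      unfolding sl2_equiv_def by auto
    have "bqf_subst \<delta> (-\<beta>) (-\<gamma>) \<alpha> g =
        bqf_subst (\<alpha>*\<delta> - \<beta>*\<gamma>) 0 0 (\<alpha>*\<delta> - \<beta>*\<gamma>) f"
      unfolding g bqf_subst_comp by (simp add: algebra_simps)
    then have "f = bqf_subst \<delta> (-\<beta>) (-\<gamma>) \<alpha> g" unfolding det by (cases f) simp
    moreover have "\<delta>*\<alpha> - (-\<beta>)*(-\<gamma>) = 1" using det by (simp add: algebra_simps)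
    ultimately show "(g, f) \<in> sl2_equiv" unfolding sl2_equiv_def by blast
  qed
  show "trans sl2_equiv"
  proof (rule transI)
    fix f g h assume "(f, g) \<in> sl2_equiv" "(g, h) \<in> sl2_equiv"
    then obtain \<alpha> \<beta> \<gamma> \<delta> \<alpha>' \<beta>' \<gamma>' \<delta>' where det: "\<alpha>*\<delta> - \<beta>*\<gamma> = 1" "\<alpha>'*\<delta>' - \<beta>'*\<gamma>' = 1"
      and g: "g = bqf_subst \<alpha> \<beta> \<gamma> \<delta> f" and h: "h = bqf_subst \<alpha>' \<beta>' \<gamma>' \<delta>' g"
      unfolding sl2_equiv_def by auto
    have "(\<alpha>*\<alpha>' + \<beta>*\<gamma>') * (\<gamma>*\<beta>' + \<delta>*\<delta>') - (\<alpha>*\<beta>' + \<beta>*\<delta>') * (\<gamma>*\<alpha>' + \<delta>*\<gamma>')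
        = (\<alpha>*\<delta> - \<beta>*\<gamma>) * (\<alpha>'*\<delta>' - \<beta>'*\<gamma>')" by (simp add: algebra_simps)
    then show "(f, h) \<in> sl2_equiv" unfolding sl2_equiv_def h g bqf_subst_comp using det by auto
  qed
qed

lemma sl2_equiv_sym: "(f, g) \<in> sl2_equiv \<Longrightarrow> (g, f) \<in> sl2_equiv"
  using equiv_sl2 by (meson equivE symE)

lemma sl2_equiv_trans: "(f, g) \<in> sl2_equiv \<Longrightarrow> (g, h) \<in> sl2_equiv \<Longrightarrow> (f, h) \<in> sl2_equiv"
  using equiv_sl2 by (meson equivE transE)

lemma sl2_equiv_refl [simp]: "(f, f) \<in> sl2_equiv"
  using equiv_sl2 by (meson UNIV_I equivE refl_onD)

lemma sl2_equivI:
  "\<alpha>*\<delta> - \<beta>*\<gamma> = 1 \<Longrightarrow> g = bqf_subst \<alpha> \<beta> \<gamma> \<delta> f \<Longrightarrow> (f, g) \<in> sl2_equiv"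
  unfolding sl2_equiv_def by blast

lemma sl2_equiv_swap: "((a, b, c), (c, - b, a)) \<in> sl2_equiv"
  by (rule sl2_equivI[of 0 0 "-1" 1]) simp_all

lemma sl2_equiv_shift: "((a, b, c), (a, b + 2 * a * k, a * k\<^sup>2 + b * k + c)) \<in> sl2_equiv"
  by (rule sl2_equivI[of 1 1 k 0]) (simp_all add: algebra_simps)

lemma posdef_equiv:
  assumes "f \<in> posdef_forms N" "(f, g) \<in> sl2_equiv"
  shows "g \<in> posdef_forms N"
proof -
  obtain \<alpha> \<beta> \<gamma> \<delta> where det: "\<alpha>*\<delta> - \<beta>*\<gamma> = 1" and g: "g = bqf_subst \<alpha> \<beta> \<gamma> \<delta> f"
    using assms(2) unfolding sl2_equiv_def by auto
  obtain a b c where f: "f = (a, b, c)" by (cases f)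
  obtain a' b' c' where g': "g = (a', b', c')" by (cases g)
  have h: "b\<^sup>2 - 4*a*c = - N" "0 < N" "0 < a" using assms(1) unfolding posdef_forms_def f by auto
  have e: "a' = a*\<alpha>^2 + b*\<alpha>*\<gamma> + c*\<gamma>^2" "b' = 2*a*\<alpha>*\<beta> + b*(\<alpha>*\<delta> + \<beta>*\<gamma>) + 2*c*\<gamma>*\<delta>"
    "c' = a*\<beta>^2 + b*\<beta>*\<delta> + c*\<delta>^2" using g unfolding g' f by auto
  have "b'\<^sup>2 - 4*a'*c' = (\<alpha>*\<delta> - \<beta>*\<gamma>)\<^sup>2 * (b\<^sup>2 - 4*a*c)"
    unfolding e by (simp add: algebra_simps power2_eq_square)
  then have d: "b'\<^sup>2 - 4*a'*c' = - N" unfolding det h by simp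
  have "4*a*a' = (2*a*\<alpha> + b*\<gamma>)\<^sup>2 - (b\<^sup>2 - 4*a*c) * \<gamma>\<^sup>2"
    unfolding e by (simp add: algebra_simps power2_eq_square)
  then have i: "4*a*a' = (2*a*\<alpha> + b*\<gamma>)\<^sup>2 + N * \<gamma>\<^sup>2" unfolding h by simp
  have "0 < (2*a*\<alpha> + b*\<gamma>)\<^sup>2 + N * \<gamma>\<^sup>2"
  proof (cases "\<gamma> = 0")
    case True
    then have "\<alpha> \<noteq> 0" using det by auto
    then show ?thesis using True h by simp
  next
    case False
    then show ?thesis using h by (simp add: add_nonneg_pos)
  qed
  then have "0 < a'" using i h(3) by (metis mult.assoc zero_less_mult_pos zero_less_numeral mult_pos_pos)
  then show ?thesis using d h(2) unfolding g' posdef_forms_def by simp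
qed

lemma posdef_pos:
  assumes "(a, b, c) \<in> posdef_forms N" shows "0 < a" "0 < c" "4 * a * c - b\<^sup>2 = N" "0 < N"
proof -
  show 1: "0 < a" "4 * a * c - b\<^sup>2 = N" "0 < N" using assms by (auto simp: posdef_forms_def)
  have "0 < 4 * a * c" using 1 zero_le_power2[of b] by linarith
  then show "0 < c" using 1(1) by (simp add: zero_less_mult_iff)
qed

text \<open>In terms of l = 2a + b, m = 2c + b, n = -b, this says that n is nonnegative and minimal.
  The two implications break ties: between the two orders when n = 0, and between rotations of (l,
  m, n) when n = m.\<close>

fun sreduced :: "bqf \<Rightarrow> bool" where
  "sreduced (a, b, c) \<longleftrightarrow> b \<le> 0 \<and> - b \<le> a \<and> - b \<le> c \<and> (b = 0 \<longrightarrow> a \<le> c) \<and> (- b = c \<longrightarrow> a = c)"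

text \<open>A form of the class with least leading coefficient is translated until its middle
  coefficient is small. The last coefficient also leads an equivalent form, whence a \<le>
  c.\<close>

lemma ex_sreduced:
  assumes "f \<in> posdef_forms N"
  shows "\<exists>g. g \<in> posdef_forms N \<and> sreduced g \<and> (f, g) \<in> sl2_equiv"
proof -
  obtain g where fg: "(f, g) \<in> sl2_equiv" and min: "\<And>h. (f, h) \<in> sl2_equiv \<Longrightarrow> nat (fst g) \<le> nat (fst h)"
    using ex_has_least_nat[of "\<lambda>g. (f, g) \<in> sl2_equiv" f "\<lambda>g. nat (fst g)", OF sl2_equiv_refl] by blast
  obtain a b0 c0 where g: "g = (a, b0, c0)" by (cases g)
  have a: "0 < a" using posdef_pos(1) posdef_equiv[OF assms fg] unfolding g by blast
  \<comment> \<open>This puts b into the half-open interval from -a to a. For b > 0 the strict bound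
    b < a makes the tie-breaking clause vacuous after the swap.\<close>
  define k where "k = - ((b0 + a) div (2 * a))"
  define b c where "b = b0 + 2 * a * k" and "c = a * k\<^sup>2 + b0 * k + c0"
  have "b = (b0 + a) mod (2 * a) - a"
    unfolding b_def k_def minus_div_mult_eq_mod[symmetric] by (simp add: algebra_simps)
  then have b: "- a \<le> b" "b < a"
    using a pos_mod_bound[of "2 * a" "b0 + a"] pos_mod_sign[of "2 * a" "b0 + a"] by simp_all
  have eq: "(f, (a, b, c)) \<in> sl2_equiv"
    using fg sl2_equiv_shift[of a b0 c0 k] sl2_equiv_trans unfolding g b_def c_def by blast
  have eq': "(f, (c, - b, a)) \<in> sl2_equiv"
    using eq sl2_equiv_swap sl2_equiv_trans by blast
  have "0 < c" using posdef_pos(1) posdef_equiv[OF assms eq'] by blast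
  then have ac: "a \<le> c" using min[OF eq'] unfolding g by simp
  show ?thesis
  proof (cases "b \<le> 0")
    case True
    then have "sreduced (a, b, c)" using b ac by auto
    then show ?thesis using eq posdef_equiv[OF assms eq] by blast
  next
    case False
    then have "sreduced (c, - b, a)" using b ac by auto
    then show ?thesis using eq' posdef_equiv[OF assms eq'] by blast
  qed
qed

section \<open>Uniqueness of the reduced form via Eisenstein norms\<close>

lemma eisenstein_norm_pos:
  fixes x y :: int shows "1 \<le> x * x + x * y + y * y \<longleftrightarrow> x \<noteq> 0 \<or> y \<noteq> 0"
proof -
  have e: "4 * (x * x + x * y + y * y) = (2 * x + y)\<^sup>2 + 3 * y\<^sup>2"
    by (simp add: algebra_simps power2_eq_square)
  have "0 < (2 * x + y)\<^sup>2 + 3 * y\<^sup>2 \<longleftrightarrow> x \<noteq> 0 \<or> y \<noteq> 0"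
    by (cases "y = 0") (auto simp: add_nonneg_pos)
  moreover have "1 \<le> q \<longleftrightarrow> 0 < 4 * q" for q :: int by linarith
  ultimately show ?thesis unfolding e[symmetric] by blast
qed

lemma eisenstein_norm_one:
  fixes x y :: int assumes "x * x + x * y + y * y = 1"
  shows "(x, y) \<in> {(1, 0), (-1, 0), (0, 1), (0, -1), (1, -1), (-1, 1)}"
proof -
  have "4 * (x * x + x * y + y * y) = (2 * x + y)\<^sup>2 + 3 * y\<^sup>2" "4 * (x * x + x * y + y * y) = (2 * y + x)\<^sup>2 + 3 * x\<^sup>2"
    by (simp_all add: algebra_simps power2_eq_square)
  then have "(2 * x + y)\<^sup>2 + 3 * y\<^sup>2 = 4" "(2 * y + x)\<^sup>2 + 3 * x\<^sup>2 = 4" unfolding assms by simp_all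
  moreover have "0 \<le> (2 * x + y)\<^sup>2" "0 \<le> (2 * y + x)\<^sup>2" by simp_all
  ultimately have "3 * y\<^sup>2 \<le> 4" "3 * x\<^sup>2 \<le> 4" by linarith+
  then have "y\<^sup>2 \<le> 1" "x\<^sup>2 \<le> 1" by linarith+
  then have "\<bar>y\<bar> \<le> 1" "\<bar>x\<bar> \<le> 1" by (simp_all add: abs_square_le_1)
  then have "x = -1 \<or> x = 0 \<or> x = 1" "y = -1 \<or> y = 0 \<or> y = 1" by linarith+
  then show ?thesis using assms by auto
qed

text \<open>Selling's argument: with l = 2a + b, m = 2c + b, n = -b, the form is
  (l x^2 + m y^2 + n (x - y)^2) / 2, and the sum of its values at a superbase is
  l Q(\<alpha>, \<beta>) + m Q(\<gamma>, \<delta>) + n Q(\<alpha> - \<gamma>, \<beta> - \<delta>) with Q(x, y) = x^2 + x y + y^2.\<close>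
lemma superbase_sum:
  assumes "(a', b', c') = bqf_subst \<alpha> \<beta> \<gamma> \<delta> (a, b, c)"
  shows "2 * a' + 2 * c' + b' = (2 * a + b) * (\<alpha>*\<alpha> + \<alpha>*\<beta> + \<beta>*\<beta>) + (2 * c + b) * (\<gamma>*\<gamma> + \<gamma>*\<delta> + \<delta>*\<delta>)
     + (- b) * ((\<alpha>-\<gamma>)*(\<alpha>-\<gamma>) + (\<alpha>-\<gamma>)*(\<beta>-\<delta>) + (\<beta>-\<delta>)*(\<beta>-\<delta>))"
  using assms by (simp add: algebra_simps power2_eq_square)

text \<open>A norm below 1 would mean that one of the rows, or their difference, is zero, and then
  the determinant would vanish.\<close>

lemma superbase_norms:
  fixes \<alpha> \<beta> \<gamma> \<delta> :: int
  assumes "\<alpha>*\<delta> - \<beta>*\<gamma> = 1"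
  shows "1 \<le> \<alpha>*\<alpha> + \<alpha>*\<beta> + \<beta>*\<beta>" "1 \<le> \<gamma>*\<gamma> + \<gamma>*\<delta> + \<delta>*\<delta>"
    "1 \<le> (\<alpha>-\<gamma>)*(\<alpha>-\<gamma>) + (\<alpha>-\<gamma>)*(\<beta>-\<delta>) + (\<beta>-\<delta>)*(\<beta>-\<delta>)"
  unfolding eisenstein_norm_pos using assms by (auto simp: mult.commute)

text \<open>Reducedness makes the three Selling parameters nonnegative, and each is multiplied by a
  norm that is at least 1.\<close>

lemma superbase_sum_le:
  assumes "((a, b, c), (a', b', c')) \<in> sl2_equiv" "sreduced (a, b, c)" "0 < a" "0 < c"
  shows "2 * a + 2 * c + b \<le> 2 * a' + 2 * c' + b'"
proof -
  obtain \<alpha> \<beta> \<gamma> \<delta> where det: "\<alpha>*\<delta> - \<beta>*\<gamma> = 1" and g: "(a', b', c') = bqf_subst \<alpha> \<beta> \<gamma> \<delta> (a, b, c)"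
    using assms(1) unfolding sl2_equiv_def by blast
  have "2 * a + 2 * c + b = (2 * a + b) * 1 + (2 * c + b) * 1 + (- b) * 1" by simp
  also have "\<dots> \<le> 2 * a' + 2 * c' + b'"
    unfolding superbase_sum[OF g] using superbase_norms[OF det] assms(2,3,4)
    by (intro add_mono mult_left_mono) auto
  finally show ?thesis .
qed

text \<open>This is the equality case of the minimality above. Since l and m are positive, the two
  rows have Eisenstein norm 1, and so has their difference unless n = 0; finitely many substitutions
  remain.\<close>

lemma sreduced_unique:
  assumes eq: "((a, b, c), (a', b', c')) \<in> sl2_equiv" and red: "sreduced (a, b, c)" "sreduced (a', b', c')"
    and pos: "0 < a" "0 < c" "0 < a'" "0 < c'"
  shows "(a, b, c) = (a', b', c')"
proof -
  obtain \<alpha> \<beta> \<gamma> \<delta> where det: "\<alpha>*\<delta> - \<beta>*\<gamma> = 1" and g: "(a', b', c') = bqf_subst \<alpha> \<beta> \<gamma> \<delta> (a, b, c)"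
    using eq unfolding sl2_equiv_def by blast
  define q1 q2 q3 where "q1 = \<alpha>*\<alpha> + \<alpha>*\<beta> + \<beta>*\<beta>" and "q2 = \<gamma>*\<gamma> + \<gamma>*\<delta> + \<delta>*\<delta>"
    and "q3 = (\<alpha>-\<gamma>)*(\<alpha>-\<gamma>) + (\<alpha>-\<gamma>)*(\<beta>-\<delta>) + (\<beta>-\<delta>)*(\<beta>-\<delta>)"
  have ge: "1 \<le> q1" "1 \<le> q2" "1 \<le> q3" using superbase_norms[OF det] unfolding q1_def q2_def q3_def by simp_all
  have "2 * a' + 2 * c' + b' = 2 * a + 2 * c + b"
    using superbase_sum_le[OF eq red(1) pos(1,2)] superbase_sum_le[OF sl2_equiv_sym[OF eq] red(2) pos(3,4)] by simp
  then have sum: "(2 * a + b) * (q1 - 1) + (2 * c + b) * (q2 - 1) + (- b) * (q3 - 1) = 0"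
    using superbase_sum[OF g] unfolding q1_def q2_def q3_def by (simp add: algebra_simps)
  have lm: "0 < 2 * a + b" "0 < 2 * c + b" "0 \<le> - b" using red(1) pos by auto
  have nn: "0 \<le> (2 * a + b) * (q1 - 1)" "0 \<le> (2 * c + b) * (q2 - 1)" "0 \<le> (- b) * (q3 - 1)"
    using lm ge by (intro mult_nonneg_nonneg; simp)+
  have "(2 * a + b) * (q1 - 1) = 0" "(2 * c + b) * (q2 - 1) = 0" "(- b) * (q3 - 1) = 0"
    using sum nn by linarith+
  then have q: "q1 = 1" "q2 = 1" and b3: "b = 0 \<or> q3 = 1" using lm by auto
  have m: "(\<alpha>, \<beta>) \<in> {(1, 0), (-1, 0), (0, 1), (0, -1), (1, -1), (-1, 1)}"
     "(\<gamma>, \<delta>) \<in> {(1, 0), (-1, 0), (0, 1), (0, -1), (1, -1), (-1, 1)}"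
    using eisenstein_norm_one[OF q(1)[unfolded q1_def]] eisenstein_norm_one[OF q(2)[unfolded q2_def]] by blast+
  have e: "a' = a*\<alpha>^2 + b*\<alpha>*\<gamma> + c*\<gamma>^2" "b' = 2*a*\<alpha>*\<beta> + b*(\<alpha>*\<delta> + \<beta>*\<gamma>) + 2*c*\<gamma>*\<delta>"
    "c' = a*\<beta>^2 + b*\<beta>*\<delta> + c*\<delta>^2" using g by auto
  have D: "thesis" if "(x, y) \<in> {(1, 0), (-1, 0), (0, 1), (0, -1), (1, -1), (-1, 1)}"
     "x = 1 \<Longrightarrow> y = 0 \<Longrightarrow> thesis" "x = -1 \<Longrightarrow> y = 0 \<Longrightarrow> thesis" "x = 0 \<Longrightarrow> y = 1 \<Longrightarrow> thesis"
     "x = 0 \<Longrightarrow> y = -1 \<Longrightarrow> thesis" "x = 1 \<Longrightarrow> y = -1 \<Longrightarrow> thesis" "x = -1 \<Longrightarrow> y = 1 \<Longrightarrow> thesis"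
    for x y :: int and thesis
    using that by blast
  have b3': "b = 0 \<or> (\<alpha>-\<gamma>)*(\<alpha>-\<gamma>) + (\<alpha>-\<gamma>)*(\<beta>-\<delta>) + (\<beta>-\<delta>)*(\<beta>-\<delta>) = 1"
    using b3 unfolding q3_def .
  \<comment> \<open>The first three cases are the rotations of (l, m, n), the fourth is the swap of
    a diagonal form. The others arise only for n = 0, where the norm of the difference is
    unconstrained. Reducedness of both forms leaves only equality.\<close>
  consider "a' = a" "b' = b" "c' = c" | "a' = c" "b' = - b - 2 * c" "c' = a + b + c"
    | "a' = a + b + c" "b' = - 2 * a - b" "c' = a" | "b = 0" "a' = c" "b' = - b" "c' = a"
    | "b = 0" "a' = a" "b' = 2 * a" | "b = 0" "b' = - 2 * a" "a' = a" "c' = a + c" | "b = 0" "b' = - 2 * c" "a' = a + c" "c' = c"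
    by (rule D[OF m(1)]; rule D[OF m(2)]) (use det e b3' in simp_all)
  then show ?thesis
    using red pos unfolding sreduced.simps prod.inject by cases (smt (verit))+
qed

section \<open>Class numbers as lattice point counts\<close>

fun sweight :: "bqf \<Rightarrow> real" where
  "sweight (a, b, c) = (if b = 0 \<and> a = c then 1 / 2 else if b = - a \<and> a = c then 1 / 3 else 1)"

definition sreduced_forms :: "int \<Rightarrow> bqf set" where
  "sreduced_forms N = {f \<in> posdef_forms N. sreduced f}"

lemma sreduced_forms_unique:
  assumes "(f, g) \<in> sl2_equiv" "f \<in> sreduced_forms N" "g \<in> sreduced_forms N"
  shows "f = g"
proof -
  obtain a b c a' b' c' where fg: "f = (a, b, c)" "g = (a', b', c')" by (cases f, cases g)
  then have "(a, b, c) \<in> posdef_forms N" "(a', b', c') \<in> posdef_forms N" "sreduced (a, b, c)" "sreduced (a', b', c')"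
    using assms unfolding sreduced_forms_def by auto
  then show ?thesis
    using sreduced_unique[of a b c a' b' c'] assms(1) posdef_pos unfolding fg by blast
qed

text \<open>The exceptional forms have reduced representatives (k, 0, k) and (k, -k, k), so by
  uniqueness the weight can be read off from the reduced form.\<close>

lemma class_weight_sreduced:
  assumes "f \<in> sreduced_forms N"
  shows "class_weight (sl2_equiv `` {f}) = sweight f"
proof -
  obtain a b c where f: "f = (a, b, c)" by (cases f)
  have pf: "(a, b, c) \<in> posdef_forms N" and red: "sreduced (a, b, c)" using assms unfolding f sreduced_forms_def by auto
  have 1: "(\<exists>k. (k, 0, k) \<in> sl2_equiv `` {f}) \<longleftrightarrow> b = 0 \<and> a = c"
  proof
    assume "\<exists>k. (k, 0, k) \<in> sl2_equiv `` {f}"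
    then obtain k where k: "(f, (k, 0, k)) \<in> sl2_equiv" by auto
    then have "(k, 0, k) \<in> posdef_forms N" using posdef_equiv pf unfolding f by blast
    then have "(k, 0, k) \<in> sreduced_forms N" using posdef_pos unfolding sreduced_forms_def by fastforce
    from sreduced_forms_unique[OF k assms this] show "b = 0 \<and> a = c" unfolding f by auto
  next
    assume "b = 0 \<and> a = c"
    then have "f = (c, 0, c)" using f by simp
    then show "\<exists>k. (k, 0, k) \<in> sl2_equiv `` {f}" by (metis Image_singleton_iff sl2_equiv_refl)
  qed
  have 2: "(\<exists>k. (k, k, k) \<in> sl2_equiv `` {f}) \<longleftrightarrow> b = - a \<and> a = c"
  proof
    assume "\<exists>k. (k, k, k) \<in> sl2_equiv `` {f}"
    then obtain k where k: "(f, (k, k, k)) \<in> sl2_equiv" by auto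
    then have k': "(f, (k, - k, k)) \<in> sl2_equiv" using sl2_equiv_swap sl2_equiv_trans by blast
    then have "(k, - k, k) \<in> posdef_forms N" using posdef_equiv pf unfolding f by blast
    then have "(k, - k, k) \<in> sreduced_forms N" using posdef_pos unfolding sreduced_forms_def by fastforce
    from sreduced_forms_unique[OF k' assms this] show "b = - a \<and> a = c" unfolding f by auto
  next
    assume "b = - a \<and> a = c"
    then have "f = (c, - c, c)" using f by simp
    then have "(f, (c, c, c)) \<in> sl2_equiv" using sl2_equiv_swap[of c "- c" c] by simp
    then show "\<exists>k. (k, k, k) \<in> sl2_equiv `` {f}" by blast
  qed
  show ?thesis unfolding class_weight_def 1 2 unfolding f by simp
qed

lemma hurwitz_sreduced:
  assumes "0 < N" "N mod 4 = 0 \<or> N mod 4 = 3"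
  shows "hurwitz N = (\<Sum>f\<in>sreduced_forms N. sweight f)"
proof -
  have "inj_on (\<lambda>f. sl2_equiv `` {f}) (sreduced_forms N)"
  proof (rule inj_onI)
    fix f g assume "f \<in> sreduced_forms N" "g \<in> sreduced_forms N" "sl2_equiv `` {f} = sl2_equiv `` {g}"
    then show "f = g" using sreduced_forms_unique eq_equiv_class[OF _ equiv_sl2] by blast
  qed
  moreover have "(\<lambda>f. sl2_equiv `` {f}) ` sreduced_forms N = bqf_classes N"
  proof (intro equalityI subsetI)
    fix C assume "C \<in> (\<lambda>f. sl2_equiv `` {f}) ` sreduced_forms N"
    then show "C \<in> bqf_classes N" unfolding bqf_classes_def sreduced_forms_def by (auto intro: quotientI)
  next
    fix C assume "C \<in> bqf_classes N"
    then obtain f where f: "f \<in> posdef_forms N" "C = sl2_equiv `` {f}"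
      unfolding bqf_classes_def by (auto elim: quotientE)
    then obtain g where "g \<in> sreduced_forms N" "(f, g) \<in> sl2_equiv"
      using ex_sreduced[OF f(1)] unfolding sreduced_forms_def by blast
    then show "C \<in> (\<lambda>f. sl2_equiv `` {f}) ` sreduced_forms N"
      using f(2) equiv_class_eq[OF equiv_sl2] by blast
  qed
  ultimately have "(\<Sum>C\<in>bqf_classes N. class_weight C) = (\<Sum>f\<in>sreduced_forms N. class_weight (sl2_equiv `` {f}))"
    using sum.reindex by fastforce
  also have "\<dots> = (\<Sum>f\<in>sreduced_forms N. sweight f)"
    by (rule sum.cong) (simp_all add: class_weight_sreduced)
  finally show ?thesis unfolding hurwitz_def using assms by auto
qed

text \<open>The triples (2 a + b, 2 c + b, -b) of the forms whose three parameters are all positive.\<close>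
definition selling_triples :: "int \<Rightarrow> (int \<times> int \<times> int) set" where
  "selling_triples N = {(l, m, n). 0 < l \<and> 0 < m \<and> 0 < n \<and> even (l + n) \<and> even (m + n) \<and> l * m + m * n + n * l = N}"

text \<open>The forms with n = 0. Both orders of (a, c) are kept, so a class occurs twice, or once
  when a = c and its weight is 1/2.\<close>

definition diag_forms :: "int \<Rightarrow> (int \<times> int) set" where
  "diag_forms N = {(a, c). 0 < a \<and> 0 < c \<and> 4 * a * c = N}"

lemma finite_selling_triples: "finite (selling_triples N)"
proof (rule finite_subset)
  show "selling_triples N \<subseteq> {0..N} \<times> {0..N} \<times> {0..N}"
  proof
    fix t assume "t \<in> selling_triples N"
    then obtain l m n where t: "t = (l, m, n)" and h: "0 < l" "0 < m" "0 < n" "l * m + m * n + n * l = N"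
      unfolding selling_triples_def by auto
    have "l \<le> l * m" "m \<le> m * n" "n \<le> n * l" "0 < l * m" "0 < m * n" "0 < n * l"
      using h by (simp_all add: le_mult_pos_int)
    then have "l \<le> N" "m \<le> N" "n \<le> N" using h(4) by linarith+
    then show "t \<in> {0..N} \<times> {0..N} \<times> {0..N}" using t h(1-3) by simp
  qed
qed simp

lemma finite_diag_forms: "finite (diag_forms N)"
proof (rule finite_subset)
  show "diag_forms N \<subseteq> {0..N} \<times> {0..N}"
  proof
    fix t assume "t \<in> diag_forms N"
    then obtain a c where t: "t = (a, c)" and h: "0 < a" "0 < c" "4 * (a * c) = N"
      unfolding diag_forms_def by auto
    have "a \<le> a * c" "c \<le> a * c" using h by (simp_all add: le_mult_pos_int)
    then show "t \<in> {0..N} \<times> {0..N}" using t h by auto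
  qed
qed simp

text \<open>Selects the rotation with n minimal, breaking ties as \<open>sreduced\<close> does, and
  carries the weight 1/3 when all three entries agree.\<close>

definition triple_weight :: "int \<Rightarrow> int \<Rightarrow> int \<Rightarrow> real" where
  "triple_weight l m n = (if n < l \<and> n < m \<or> n = l \<and> n < m then 1 else if n = l \<and> n = m then 1 / 3 else 0)"

text \<open>A class without diagonal forms contributes the three rotations of the triple of its reduced form;
  they coincide precisely when the class has weight 1/3.\<close>
lemma triple_weight_rotate:
  "triple_weight l m n + triple_weight m n l + triple_weight n l m = 1"
  by (cases rule: linorder_cases[of l m]; cases rule: linorder_cases[of m n]; cases rule: linorder_cases[of l n];
      simp add: triple_weight_def)

lemma sum_triple_weight:
  "(\<Sum>(l, m, n)\<in>selling_triples N. triple_weight l m n) = card (selling_triples N) / 3"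
proof -
  let ?T = "selling_triples N"
  have 1: "(\<Sum>(l, m, n)\<in>?T. triple_weight l m n) = (\<Sum>(l, m, n)\<in>?T. triple_weight m n l)"
    by (rule sum.reindex_bij_witness[where i = "\<lambda>(l, m, n). (m, n, l)" and j = "\<lambda>(l, m, n). (n, l, m)"])
       (auto simp: selling_triples_def algebra_simps)
  have 2: "(\<Sum>(l, m, n)\<in>?T. triple_weight l m n) = (\<Sum>(l, m, n)\<in>?T. triple_weight n l m)"
    by (rule sum.reindex_bij_witness[where i = "\<lambda>(l, m, n). (n, l, m)" and j = "\<lambda>(l, m, n). (m, n, l)"])
       (auto simp: selling_triples_def algebra_simps)
  have "(\<Sum>(l, m, n)\<in>?T. triple_weight l m n) + (\<Sum>(l, m, n)\<in>?T. triple_weight m n l) + (\<Sum>(l, m, n)\<in>?T. triple_weight n l m)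
     = (\<Sum>(l, m, n)\<in>?T. 1)"
    unfolding case_prod_unfold sum.distrib[symmetric] by (simp add: triple_weight_rotate)
  then show ?thesis using 1 2 by (simp add: case_prod_unfold)
qed

text \<open>For n > 0 the weighted classes are one third of the triples, by rotation. For n = 0 they
  are half of the ordered pairs, by the swap, hence the factor 3/2.\<close>

lemma hurwitz_count:
  assumes "0 < N" "N mod 4 = 0 \<or> N mod 4 = 3"
  shows "3 * hurwitz N = card (selling_triples N) + 3 / 2 * card (diag_forms N)"
proof -
  let ?R = "sreduced_forms N"
  let ?w = "\<lambda>a c. of_bool (a \<le> c) * (if a = c then 1 / 2 else 1) :: real"
  have neg: "(\<Sum>f\<in>{f \<in> ?R. fst (snd f) < 0}. sweight f) = (\<Sum>(l, m, n)\<in>{(l, m, n) \<in> selling_triples N. triple_weight l m n \<noteq> 0}. triple_weight l m n)"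
  proof (rule sum.reindex_bij_witness[where i = "\<lambda>(l, m, n). ((l + n) div 2, - n, (m + n) div 2)" and j = "\<lambda>(a, b, c). (2 * a + b, 2 * c + b, - b)"])
    fix f assume "f \<in> {f \<in> ?R. fst (snd f) < 0}"
    then obtain a b c where f: "f = (a, b, c)" and "(a, b, c) \<in> posdef_forms N" "sreduced (a, b, c)" "b < 0"
      unfolding sreduced_forms_def by (cases f) auto
    note h = posdef_pos[OF this(2)] this(3,4)
    show "(case case f of (a, b, c) \<Rightarrow> (2 * a + b, 2 * c + b, - b) of (l, m, n) \<Rightarrow> ((l + n) div 2, - n, (m + n) div 2)) = f"
      unfolding f by simp
    show "(case f of (a, b, c) \<Rightarrow> (2 * a + b, 2 * c + b, - b)) \<in> {(l, m, n) \<in> selling_triples N. triple_weight l m n \<noteq> 0}"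
      using h unfolding f selling_triples_def triple_weight_def by (auto simp: algebra_simps power2_eq_square)
    show "(case case f of (a, b, c) \<Rightarrow> (2 * a + b, 2 * c + b, - b) of (l, m, n) \<Rightarrow> triple_weight l m n) = sweight f"
      using h unfolding f triple_weight_def by auto
  next
    fix t assume "t \<in> {(l, m, n) \<in> selling_triples N. triple_weight l m n \<noteq> 0}"
    then obtain l m n where t: "t = (l, m, n)" and tr: "(l, m, n) \<in> selling_triples N" and w: "triple_weight l m n \<noteq> 0" by auto
    from tr have h: "0 < l" "0 < m" "0 < n" "even (l + n)" "even (m + n)" "l * m + m * n + n * l = N"
      unfolding selling_triples_def by auto
    obtain a where "l + n = 2 * a" using h(4) by (rule evenE)
    moreover obtain c where "m + n = 2 * c" using h(5) by (rule evenE)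
    ultimately have l: "l = 2 * a - n" and m: "m = 2 * c - n" by auto
    show "(case case t of (l, m, n) \<Rightarrow> ((l + n) div 2, - n, (m + n) div 2) of (a, b, c) \<Rightarrow> (2 * a + b, 2 * c + b, - b)) = t"
      unfolding t l m by simp
    show "(case t of (l, m, n) \<Rightarrow> ((l + n) div 2, - n, (m + n) div 2)) \<in> {f \<in> ?R. fst (snd f) < 0}"
      using h w assms(1) unfolding t l m sreduced_forms_def posdef_forms_def triple_weight_def
      by (auto simp: algebra_simps power2_eq_square split: if_splits)
  qed
  have zero: "(\<Sum>f\<in>{f \<in> ?R. fst (snd f) = 0}. sweight f) = (\<Sum>(a, c)\<in>{(a, c) \<in> diag_forms N. a \<le> c}. if a = c then 1 / 2 else 1)"
    by (rule sum.reindex_bij_witness[where i = "\<lambda>(a, c). (a, 0, c)" and j = "\<lambda>(a, b, c). (a, c)"])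
       (use assms(1) in \<open>auto simp: sreduced_forms_def diag_forms_def posdef_forms_def zero_less_mult_iff\<close>)
  have neg': "(\<Sum>(l, m, n)\<in>{(l, m, n) \<in> selling_triples N. triple_weight l m n \<noteq> 0}. triple_weight l m n) = (\<Sum>(l, m, n)\<in>selling_triples N. triple_weight l m n)"
    by (rule sum.mono_neutral_left) (auto simp: finite_selling_triples)
  have zero': "(\<Sum>(a, c)\<in>{(a, c) \<in> diag_forms N. a \<le> c}. if a = c then 1 / 2 else 1) = (\<Sum>(a, c)\<in>diag_forms N. ?w a c)"
    by (rule sum.mono_neutral_cong_left) (auto simp: finite_diag_forms)
  have "(\<Sum>(a, c)\<in>diag_forms N. ?w a c) = (\<Sum>(a, c)\<in>diag_forms N. ?w c a)"
    by (rule sum.reindex_bij_witness[where i = "\<lambda>(a, c). (c, a)" and j = "\<lambda>(a, c). (c, a)"])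
       (auto simp: diag_forms_def algebra_simps)
  moreover have "(\<Sum>(a, c)\<in>diag_forms N. ?w a c) + (\<Sum>(a, c)\<in>diag_forms N. ?w c a) = (\<Sum>(a, c)\<in>diag_forms N. 1)"
    unfolding case_prod_unfold sum.distrib[symmetric] by (rule sum.cong) auto
  ultimately have w: "(\<Sum>(a, c)\<in>diag_forms N. ?w a c) = card (diag_forms N) / 2"
    by (simp add: case_prod_unfold)
  have fin: "finite {f \<in> ?R. fst (snd f) < 0}" "finite {f \<in> ?R. fst (snd f) = 0}"
  proof -
    show "finite {f \<in> ?R. fst (snd f) < 0}"
    proof (rule finite_imageD)
      show "inj_on (\<lambda>(a, b, c). (2 * a + b, 2 * c + b, - b)) {f \<in> ?R. fst (snd f) < 0}"
        by (auto simp: inj_on_def)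
      show "finite ((\<lambda>(a, b, c). (2 * a + b, 2 * c + b, - b)) ` {f \<in> ?R. fst (snd f) < 0})"
      proof (rule finite_subset[OF _ finite_selling_triples[of N]], clarify)
        fix a b c assume "(a, b, c) \<in> ?R" "fst (snd (a, b, c)) < 0"
        then have "(a, b, c) \<in> posdef_forms N" "sreduced (a, b, c)" "b < 0" unfolding sreduced_forms_def by auto
        with posdef_pos[OF this(1)] show "(2 * a + b, 2 * c + b, - b) \<in> selling_triples N"
          unfolding selling_triples_def by (auto simp: algebra_simps power2_eq_square)
      qed
    qed
    have "{f \<in> ?R. fst (snd f) = 0} \<subseteq> (\<lambda>(a, c). (a, 0, c)) ` diag_forms N"
      using posdef_pos unfolding sreduced_forms_def diag_forms_def by (fastforce simp: image_iff)
    then show "finite {f \<in> ?R. fst (snd f) = 0}"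
      using finite_diag_forms finite_subset by blast
  qed
  have "?R = {f \<in> ?R. fst (snd f) < 0} \<union> {f \<in> ?R. fst (snd f) = 0}"
    unfolding sreduced_forms_def by force
  moreover have "{f \<in> ?R. fst (snd f) < 0} \<inter> {f \<in> ?R. fst (snd f) = 0} = {}" by auto
  ultimately have "hurwitz N = (\<Sum>f\<in>{f \<in> ?R. fst (snd f) < 0}. sweight f) + (\<Sum>f\<in>{f \<in> ?R. fst (snd f) = 0}. sweight f)"
    unfolding hurwitz_sreduced[OF assms] using sum.union_disjoint[OF fin, of sweight] by metis
  then show ?thesis
    unfolding neg zero neg' zero' w sum_triple_weight by simp
qed

section \<open>Sums of class numbers over traces\<close>

lemma sum_Sigma_card:
  fixes \<phi> :: "'a \<Rightarrow> real"
  assumes "finite R" "\<And>r. finite (T r)"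
  shows "(\<Sum>r\<in>R. \<phi> r * card (T r)) = (\<Sum>(r, t)\<in>Sigma R T. \<phi> r)"
  using assms by (subst sum.Sigma[symmetric]) (auto simp: mult.commute)

definition trace_range :: "int \<Rightarrow> int set" where
  "trace_range p = {r. r * r < 4 * p}"

lemma finite_trace_range: "finite (trace_range p)"
proof (rule finite_subset)
  show "trace_range p \<subseteq> {- 4 * p..4 * p}"
  proof
    fix r assume "r \<in> trace_range p"
    then have "r * r < 4 * p" by (simp add: trace_range_def)
    moreover have "\<bar>r\<bar> \<le> r * r"
      using self_le_power[of "\<bar>r\<bar>" 2] by (cases "r = 0") (auto simp: power2_eq_square)
    ultimately show "r \<in> {- 4 * p..4 * p}" by auto
  qed
qed simp

lemma prime_mult_cases:
  fixes b c :: int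
  assumes "prime p" "0 < b" "0 < c"
  shows "b * c = int p \<longleftrightarrow> b = 1 \<and> c = int p \<or> b = int p \<and> c = 1"
proof
  assume h: "b * c = int p"
  show "b = 1 \<and> c = int p \<or> b = int p \<and> c = 1"
  proof (cases "c = 1")
    case False
    then have "b = 1" using prime_factor_one[OF assms(1) h] assms by simp
    then show ?thesis using h by simp
  qed (use h in simp)
qed auto

text \<open>The pair of r and a triple is the matrix with trace r belonging to the form (c, d - a,
  b), so a - d = n and a + d = r. The sum is then split by the signs of the diagonal
  entries.\<close>

lemma sum_selling_triples:
  fixes \<phi> :: "int \<Rightarrow> real"
  assumes "prime p" and even: "\<And>r. \<phi> (- r) = \<phi> r"
  shows "(\<Sum>r\<in>trace_range (int p). \<phi> r * card (selling_triples (4 * int p - r\<^sup>2))) =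
     2 * osum \<phi> (int p) (\<lambda>a b c d. d < a \<and> a - d < 2 * b \<and> a - d < 2 * c)
      + dsum \<phi> (int p) (\<lambda>a b c d. a + d < 2 * b \<and> a + d < 2 * c) + 4 * \<phi> 1"
proof -
  define Y where "Y = {(a, b, c, d). d < a \<and> a - d < 2 * b \<and> a - d < 2 * c \<and> a * d + b * c = int p}"
  let ?Z = "Sigma (trace_range (int p)) (\<lambda>r. selling_triples (4 * int p - r\<^sup>2))"
  let ?f = "\<lambda>(a, b, c, d). \<phi> (a + d)"
  let ?i = "\<lambda>(a, b, c, d). (a + d, 2 * c - (a - d), 2 * b - (a - d), a - d :: int)"
  let ?j = "\<lambda>(r, l, m, n). ((r + n) div 2, (m + n) div 2, (l + n) div 2, (r - n) div 2 :: int)"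
  have iZ: "?i t \<in> ?Z" and ji: "?j (?i t) = t" if tY: "t \<in> Y" for t
  proof -
    obtain a b c d where t: "t = (a, b, c, d)" and h: "d < a" "a - d < 2 * b" "a - d < 2 * c" "a * d + b * c = int p"
      using tY unfolding Y_def by (cases t) auto
    let ?l = "2 * c - (a - d)" and ?m = "2 * b - (a - d)" and ?n = "a - d"
    have e: "?l * ?m + ?m * ?n + ?n * ?l = 4 * int p - (a + d)\<^sup>2"
      unfolding h(4)[symmetric] by (simp add: algebra_simps power2_eq_square)
    moreover have "0 < ?l * ?m" "0 < ?m * ?n" "0 < ?n * ?l" using h by simp_all
    ultimately have "(a + d)\<^sup>2 < 4 * int p" by linarith
    then show "?i t \<in> ?Z" using e h unfolding t trace_range_def selling_triples_def
      by (simp add: power2_eq_square)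
    show "?j (?i t) = t" unfolding t by simp
  qed
  have jY: "?j t \<in> Y" and ij: "?i (?j t) = t" and fj: "?f (?j t) = (case t of (r, s) \<Rightarrow> \<phi> r)" if tZ: "t \<in> ?Z" for t
  proof -
    obtain r l m n where t: "t = (r, l, m, n)" and h: "0 < l" "0 < m" "0 < n" "even (l + n)" "even (m + n)"
       "l * m + m * n + n * l = 4 * int p - r\<^sup>2"
      using tZ unfolding selling_triples_def by (cases t) auto
    obtain c where l: "l + n = 2 * c" using h(4) by (rule evenE)
    obtain b where m: "m + n = 2 * b" using h(5) by (rule evenE)
    \<comment> \<open>The product being a multiple of 4, r and n have the same parity, and (r + n)/2
      is an integer.\<close>
    have "(r - n) * (r + n) = 4 * (int p - b * c)"
    proof -
      have "4 * (b * c) = (m + n) * (l + n)" unfolding l m by simp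
      then show ?thesis using h(6) by (simp add: algebra_simps power2_eq_square)
    qed
    then have "even ((r - n) * (r + n))" by simp
    then have "even (r + n)" by auto
    then obtain a where a: "r + n = 2 * a" by (rule evenE)
    have v: "r = 2 * a - n" "l = 2 * c - n" "m = 2 * b - n" using a l m by auto
    have j: "?j t = (a, b, c, a - n)" unfolding t v by simp
    have "4 * (a * (a - n) + b * c) = 4 * int p" using h(6) unfolding v by (simp add: algebra_simps power2_eq_square)
    then have "a * (a - n) + b * c = int p" by simp
    then show "?j t \<in> Y" unfolding j Y_def using h(1-3) v by simp
    show "?i (?j t) = t" unfolding j t v by simp
    show "?f (?j t) = (case t of (r, s) \<Rightarrow> \<phi> r)" unfolding j t v by simp
  qed
  have fin: "finite Y"
  proof (rule inj_on_finite)
    show "inj_on ?i Y" by (rule inj_on_inverseI[where g = ?j]) (rule ji)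
    show "?i ` Y \<subseteq> ?Z" using iZ by blast
    show "finite ?Z" by (intro finite_SigmaI finite_trace_range finite_selling_triples)
  qed
  have "(\<Sum>r\<in>trace_range (int p). \<phi> r * card (selling_triples (4 * int p - r\<^sup>2))) = (\<Sum>(r, t)\<in>?Z. \<phi> r)"
    by (rule sum_Sigma_card[OF finite_trace_range finite_selling_triples])
  also have "\<dots> = sum ?f Y"
    by (rule sum.reindex_bij_witness[where i = ?i and j = ?j]) (fact ij jY ji iZ fj)+
  also have "sum ?f Y = sum ?f {(a, b, c, d) \<in> Y. 0 < d} + sum ?f {(a, b, c, d) \<in> Y. d = 0}
     + sum ?f {(a, b, c, d) \<in> Y. d < 0 \<and> 0 < a} + sum ?f {(a, b, c, d) \<in> Y. a = 0} + sum ?f {(a, b, c, d) \<in> Y. a < 0}"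
  proof -
    have "sum ?f Y = sum ?f {(a, b, c, d) \<in> Y. 0 < d} + sum ?f {(a, b, c, d) \<in> Y. d \<le> 0}"
      by (subst sum.union_disjoint[symmetric]) (auto intro!: finite_subset[OF _ fin] sum.cong)
    also have "sum ?f {(a, b, c, d) \<in> Y. d \<le> 0} = sum ?f {(a, b, c, d) \<in> Y. d = 0} + sum ?f {(a, b, c, d) \<in> Y. d < 0}"
      by (subst sum.union_disjoint[symmetric]) (auto intro!: finite_subset[OF _ fin] sum.cong)
    also have "sum ?f {(a, b, c, d) \<in> Y. d < 0} = sum ?f {(a, b, c, d) \<in> Y. d < 0 \<and> 0 < a} + sum ?f {(a, b, c, d) \<in> Y. d < 0 \<and> a \<le> 0}"
      by (subst sum.union_disjoint[symmetric]) (auto intro!: finite_subset[OF _ fin] sum.cong)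
    also have "sum ?f {(a, b, c, d) \<in> Y. d < 0 \<and> a \<le> 0} = sum ?f {(a, b, c, d) \<in> Y. a = 0} + sum ?f {(a, b, c, d) \<in> Y. a < 0}"
      by (subst sum.union_disjoint[symmetric]) (auto intro!: finite_subset[OF _ fin] sum.cong simp: Y_def)
    finally show ?thesis by simp
  qed
  also have "sum ?f {(a, b, c, d) \<in> Y. 0 < d} = osum \<phi> (int p) (\<lambda>a b c d. d < a \<and> a - d < 2 * b \<and> a - d < 2 * c)"
    unfolding osum_def by (rule sum.cong) (auto simp: Y_def sols_def)
  \<comment> \<open>The map (a, d) -> (-d, -a) keeps a d and a - d and only negates the
    trace.\<close>
  also have "sum ?f {(a, b, c, d) \<in> Y. a < 0} = osum \<phi> (int p) (\<lambda>a b c d. d < a \<and> a - d < 2 * b \<and> a - d < 2 * c)"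
  proof -
    have "\<phi> (- a - d) = \<phi> (a + d)" for a d using even[of "a + d"] by simp
    then show ?thesis unfolding osum_def
      by (intro sum.reindex_bij_witness[where i = "\<lambda>(a, b, c, d). (- d, b, c, - a)" and j = "\<lambda>(a, b, c, d). (- d, b, c, - a)"])
         (auto simp: Y_def sols_def algebra_simps)
  qed
  also have "sum ?f {(a, b, c, d) \<in> Y. d < 0 \<and> 0 < a} = dsum \<phi> (int p) (\<lambda>a b c d. a + d < 2 * b \<and> a + d < 2 * c)"
    unfolding dsum_def
    by (rule sum.reindex_bij_witness[where i = "\<lambda>(a, b, c, d). (a, b, c, - d)" and j = "\<lambda>(a, b, c, d). (a, b, c, - d)"])
       (auto simp: Y_def dsols_def algebra_simps)
  \<comment> \<open>Here b c = p, so b or c is 1 and 0 < a < 2. Together with the mirror case a = 0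
    this produces the term 4 \<phi>(1).\<close>
  also have "{(a, b, c, d) \<in> Y. d = 0} = {(1, 1, int p, 0), (1, int p, 1, 0)}"
    using prime_gt_1_nat[OF assms(1)] by (auto simp: Y_def prime_mult_cases[OF assms(1)])
  also have "{(a, b, c, d) \<in> Y. a = 0} = {(0, 1, int p, - 1), (0, int p, 1, - 1)}"
    using prime_gt_1_nat[OF assms(1)] by (auto simp: Y_def prime_mult_cases[OF assms(1)])
  finally show ?thesis
    using prime_gt_1_nat[OF assms(1)] even[of 1] by simp
qed

text \<open>The equation r^2 + 4 a c = 4 p forces r to be even, and halving r gives a solution with
  equal outer variables. Negative r mirrors positive r, and r = 0 leaves the two factorisations of
  p.\<close>

lemma sum_diag_forms:
  fixes \<phi> :: "int \<Rightarrow> real"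
  assumes "prime p" and even: "\<And>r. \<phi> (- r) = \<phi> r"
  shows "(\<Sum>r\<in>trace_range (int p). \<phi> r * card (diag_forms (4 * int p - r\<^sup>2))) =
     2 * osum \<phi> (int p) (\<lambda>a b c d. a = d) + 2 * \<phi> 0"
proof -
  let ?Z = "Sigma (trace_range (int p)) (\<lambda>r. diag_forms (4 * int p - r\<^sup>2))"
  let ?f = "\<lambda>(r, t). \<phi> r"
  have fin: "finite ?Z" by (intro finite_SigmaI finite_trace_range finite_diag_forms)
  have Z: "(r, a, c) \<in> ?Z \<longleftrightarrow> 0 < a \<and> 0 < c \<and> r * r + 4 * (a * c) = 4 * int p" for r a c
    unfolding trace_range_def diag_forms_def by (auto simp: power2_eq_square) (smt (verit) mult_pos_pos)
  have ev: "even r" if "(r, a, c) \<in> ?Z" for r a c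
  proof -
    have "r * r = 2 * (2 * (int p - a * c))" using that unfolding Z by simp
    then have "even (r * r)" by simp
    then show ?thesis by simp
  qed
  have pos: "sum ?f {(r, t) \<in> ?Z. 0 < r} = osum \<phi> (int p) (\<lambda>a b c d. a = d)"
    unfolding osum_def
  proof (rule sum.reindex_bij_witness[where i = "\<lambda>(a, b, c, d). (2 * a, b, c)" and j = "\<lambda>(r, b, c). (r div 2, b, c, r div 2)"])
    fix t assume "t \<in> {(r, t) \<in> ?Z. 0 < r}"
    then obtain r b c where t: "t = (r, b, c)" and h: "(r, b, c) \<in> ?Z" "0 < r" by auto
    obtain s where s: "r = 2 * s" using ev[OF h(1)] by (rule evenE)
    show "(case case t of (r, b, c) \<Rightarrow> (r div 2, b, c, r div 2) of (a, b, c, d) \<Rightarrow> (2 * a, b, c)) = t"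
      unfolding t s by simp
    show "(case t of (r, b, c) \<Rightarrow> (r div 2, b, c, r div 2)) \<in> sols (int p) (\<lambda>a b c d. a = d)"
      using h unfolding t s Z by (simp add: sols_def)
    show "(case case t of (r, b, c) \<Rightarrow> (r div 2, b, c, r div 2) of (a, b, c, d) \<Rightarrow> \<phi> (a + d)) = (case t of (r, t) \<Rightarrow> \<phi> r)"
      unfolding t s by simp
  next
    fix t assume "t \<in> sols (int p) (\<lambda>a b c d. a = d)"
    then obtain a b c where t: "t = (a, b, c, a)" and h: "0 < a" "0 < b" "0 < c" "a * a + b * c = int p"
      by (auto simp: sols_def)
    show "(case case t of (a, b, c, d) \<Rightarrow> (2 * a, b, c) of (r, b, c) \<Rightarrow> (r div 2, b, c, r div 2)) = t"
      unfolding t by simp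
    have "(2 * a, b, c) \<in> ?Z" unfolding Z using h by simp
    then show "(case t of (a, b, c, d) \<Rightarrow> (2 * a, b, c)) \<in> {(r, t) \<in> ?Z. 0 < r}"
      unfolding t using h(1) by simp
  qed
  have neg: "sum ?f {(r, t) \<in> ?Z. r < 0} = sum ?f {(r, t) \<in> ?Z. 0 < r}"
    by (rule sum.reindex_bij_witness[where i = "\<lambda>(r, t). (- r, t)" and j = "\<lambda>(r, t). (- r, t)"])
       (auto simp: trace_range_def even)
  have "{(r, t) \<in> ?Z. r = 0} = {(0, 1, int p), (0, int p, 1)}"
  proof -
    have e: "(0, a, c) \<in> ?Z \<longleftrightarrow> (a = 1 \<and> c = int p \<or> a = int p \<and> c = 1)" for a c
      unfolding Z using prime_mult_cases[OF assms(1), of a c] prime_gt_0_nat[OF assms(1)] by auto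
    show ?thesis
    proof (intro equalityI subsetI)
      fix t assume "t \<in> {(r, t) \<in> ?Z. r = 0}"
      then obtain a c where "t = (0, a, c)" "(0, a, c) \<in> ?Z" by auto
      then show "t \<in> {(0, 1, int p), (0, int p, 1)}" using e by blast
    next
      fix t :: "int \<times> int \<times> int" assume "t \<in> {(0, 1, int p), (0, int p, 1)}"
      then obtain a c where t: "t = (0, a, c)" and "a = 1 \<and> c = int p \<or> a = int p \<and> c = 1" by auto
      then have "(0, a, c) \<in> ?Z" using e by blast
      then show "t \<in> {(r, t) \<in> ?Z. r = 0}" unfolding t by simp
    qed
  qed
  then have zero: "sum ?f {(r, t) \<in> ?Z. r = 0} = 2 * \<phi> 0"
    using prime_gt_1_nat[OF assms(1)] by simp
  have "(\<Sum>r\<in>trace_range (int p). \<phi> r * card (diag_forms (4 * int p - r\<^sup>2))) = sum ?f ?Z"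
    by (rule sum_Sigma_card[OF finite_trace_range finite_diag_forms])
  also have "\<dots> = sum ?f {(r, t) \<in> ?Z. 0 < r} + sum ?f {(r, t) \<in> ?Z. r \<le> 0}"
    by (subst sum.union_disjoint[symmetric]) (auto intro!: finite_subset[OF _ fin] sum.cong)
  also have "sum ?f {(r, t) \<in> ?Z. r \<le> 0} = sum ?f {(r, t) \<in> ?Z. r = 0} + sum ?f {(r, t) \<in> ?Z. r < 0}"
    by (subst sum.union_disjoint[symmetric]) (auto intro!: finite_subset[OF _ fin] sum.cong)
  finally show ?thesis unfolding neg zero pos by simp
qed

lemma hurwitz_trace_sum:
  assumes "prime p" "odd p" and even: "\<And>r. \<phi> (- r) = \<phi> r"
  shows "3 * (\<Sum>r\<in>trace_range (int p). \<phi> r * hurwitz (4 * int p - r\<^sup>2)) =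
    outer_minus \<phi> (int p) - outer_plus \<phi> (int p) + 3 * \<phi> 0 + \<phi> 1 + 3 * \<phi> (int p)
      + 4 * (\<Sum>r = 1..<int p. \<phi> r) + (2 * real p - 3) * \<phi> (int p + 1)"
proof -
  let ?R = "trace_range (int p)"
  have "3 * hurwitz (4 * int p - r\<^sup>2) =
      card (selling_triples (4 * int p - r\<^sup>2)) + 3 / 2 * card (diag_forms (4 * int p - r\<^sup>2))" if "r \<in> ?R" for r
  proof (rule hurwitz_count)
    show "0 < 4 * int p - r\<^sup>2" using that by (simp add: trace_range_def power2_eq_square)
    have "r\<^sup>2 mod 4 = ((r mod 4) * (r mod 4)) mod 4" by (simp add: power2_eq_square mod_mult_eq)
    then have "r\<^sup>2 mod 4 = 0 \<or> r\<^sup>2 mod 4 = 1" by (cases rule: mod4_cases[of r]) simp_all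
    then show "(4 * int p - r\<^sup>2) mod 4 = 0 \<or> (4 * int p - r\<^sup>2) mod 4 = 3" by presburger
  qed
  then have "3 * (\<Sum>r\<in>?R. \<phi> r * hurwitz (4 * int p - r\<^sup>2)) =
     (\<Sum>r\<in>?R. \<phi> r * card (selling_triples (4 * int p - r\<^sup>2)) + 3 / 2 * (\<phi> r * card (diag_forms (4 * int p - r\<^sup>2))))"
    unfolding sum_distrib_left by (intro sum.cong) (auto simp: algebra_simps)
  also have "\<dots> = (\<Sum>r\<in>?R. \<phi> r * card (selling_triples (4 * int p - r\<^sup>2)))
     + 3 / 2 * (\<Sum>r\<in>?R. \<phi> r * card (diag_forms (4 * int p - r\<^sup>2)))"
    by (simp add: sum.distrib sum_distrib_left)
  finally show ?thesis
    unfolding sum_selling_triples[where p = p and \<phi> = \<phi>, OF assms(1) even] sum_diag_forms[where p = p and \<phi> = \<phi>, OF assms(1) even]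
    using trace_relation[where p = p and \<phi> = \<phi>, OF assms(1,2) even] by (simp add: add_divide_distrib)
qed

section \<open>Three test functions and the residue classes modulo 4\<close>

lemma sum_odd_indicator: "(\<Sum>r = 1..<int n. of_bool (odd r) :: real) = real (n div 2)"
proof (induction n)
  case (Suc n)
  show ?case
  proof (cases "n = 0")
    case False
    then have "{1..<int (Suc n)} = insert (int n) {1..<int n}" by auto
    then have "(\<Sum>r = 1..<int (Suc n). of_bool (odd r) :: real) = of_bool (odd n) + (\<Sum>r = 1..<int n. of_bool (odd r))"
      by (simp only: sum.insert finite_atLeastLessThan_int) simp
    also have "\<dots> = real (Suc n div 2)" unfolding Suc by (cases "even n") (auto elim: evenE oddE)
    finally show ?thesis .
  qed simp
qed simp

theorem theorem2:
  fixes p :: nat and c :: int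
  assumes "prime p" and "odd p"
  defines "S \<equiv> (\<Sum>r\<in>{r::int. real_of_int \<bar>r\<bar> < 2 * sqrt (real p) \<and> [r = c] (mod 4)}.
                   hurwitz (4 * int p - r^2))"
  shows "([c = 1] (mod 4) \<or> [c = -1] (mod 4) \<longrightarrow> S = (real p + 1) / 3)
       \<and> ([c = int p + 1] (mod 4) \<longrightarrow> S = (5 * real p - 7) / 6)
       \<and> ([c = int p - 1] (mod 4) \<longrightarrow> S = (real p + 1) / 2)"
proof -
  let ?R = "trace_range (int p)"
  define h where "h r = hurwitz (4 * int p - r\<^sup>2)" for r
  define H where "H k = (\<Sum>r\<in>?R. of_bool (r mod 4 = k) * h r)" for k :: int
  have range: "real_of_int \<bar>r\<bar> < 2 * sqrt (real p) \<longleftrightarrow> r \<in> ?R" for r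
  proof -
    have "real_of_int \<bar>r\<bar> < 2 * sqrt (real p) \<longleftrightarrow> sqrt (real_of_int (r * r)) < sqrt (4 * real p)"
    proof -
      have "sqrt (real_of_int (r * r)) = real_of_int \<bar>r\<bar>" by (simp add: real_sqrt_abs2)
      moreover have "sqrt (4 * real p) = 2 * sqrt (real p)" by (simp add: real_sqrt_mult)
      ultimately show ?thesis by (simp only:)
    qed
    also have "\<dots> \<longleftrightarrow> real_of_int (r * r) < real_of_int (4 * int p)"
      unfolding real_sqrt_less_iff by simp
    also have "\<dots> \<longleftrightarrow> r * r < 4 * int p" by (simp only: of_int_less_iff)
    finally show ?thesis by (simp add: trace_range_def)
  qed
  have S: "S = H (c mod 4)"
    unfolding S_def H_def range cong_def h_def
    by (rule sum.mono_neutral_cong_left) (auto simp: finite_trace_range)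
  have p4: "p mod 4 = 1 \<or> p mod 4 = 3" using assms(2) by presburger
  have ip: "int p mod 4 = int (p mod 4)" by (simp add: zmod_int)
  \<comment> \<open>The Kronecker-Hurwitz class number relation: the total over all r is 2p.\<close>
  have one: "3 * (\<Sum>r\<in>?R. h r) = 6 * real p"
    using hurwitz_trace_sum[where p = p and \<phi> = "\<lambda>_. 1", OF assms(1,2) refl] prime_gt_0_nat[OF assms(1)]
    unfolding outer_minus_def outer_plus_def h_def by (simp add: of_nat_diff)
  \<comment> \<open>The arguments a + d - b and a + d + b have the same parity, so the shifted sums
    agree.\<close>
  have odd: "3 * (\<Sum>r\<in>?R. of_bool (odd r) * h r) = 2 * (real p + 1)"
  proof -
    have "outer_minus (\<lambda>r. of_bool (odd r)) (int p) = outer_plus (\<lambda>r. of_bool (odd r)) (int p)"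
      unfolding outer_minus_def outer_plus_def by (rule sum.cong) auto
    moreover have "real (p div 2) = (real p - 1) / 2" using assms(2) by (auto elim: oddE)
    ultimately show ?thesis
      using hurwitz_trace_sum[where p = p and \<phi> = "\<lambda>r. of_bool (odd r)", OF assms(1,2)] assms(2)
      unfolding sum_odd_indicator h_def by simp
  qed
  \<comment> \<open>Here c4 (p + 1) = - s4 p, and the sum of c4 below p is 0 or -1 according to p
    mod 4. In both cases the right-hand side collapses to a multiple of s4 p.\<close>
  have c4: "3 * (\<Sum>r\<in>?R. c4 r * h r) = (5 - real p) * s4 (int p)"
    using hurwitz_trace_sum[where p = p and \<phi> = c4, OF assms(1,2) c4_minus] p4 ip assms(2)
    unfolding outer_c4[OF assms(1,2)] sum_c4 h_def c4_add by (auto simp: c4_def[of 0] c4_def[of 1] s4_def algebra_simps)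
  have H13: "H 1 = H 3"
    unfolding H_def
  proof (rule sum.reindex_bij_witness[where i = uminus and j = uminus])
    fix r :: int
    have "(- r) mod 4 = 3 \<longleftrightarrow> r mod 4 = 1" by presburger
    then show "of_bool ((- r) mod 4 = 3) * h (- r) = of_bool (r mod 4 = 1) * h r" by (simp add: h_def)
  qed (auto simp: trace_range_def)
  have "(\<Sum>r\<in>?R. of_bool (odd r) * h r) = H 1 + H 3"
    unfolding H_def sum.distrib[symmetric] by (rule sum.cong) (auto simp: odd_mod4)
  then have H1: "H 1 = (real p + 1) / 3" "H 3 = (real p + 1) / 3" using odd H13 by simp_all
  have "(\<Sum>r\<in>?R. h r) - (\<Sum>r\<in>?R. of_bool (odd r) * h r) = H 0 + H 2"
    unfolding H_def sum.distrib[symmetric] sum_subtractf[symmetric] by (rule sum.cong) (auto simp: odd_mod4 even_mod4)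
  moreover have "(\<Sum>r\<in>?R. c4 r * h r) = H 0 - H 2"
    unfolding H_def sum_subtractf[symmetric] by (rule sum.cong) (auto simp: c4_def)
  ultimately have "3 * (H 0 + H 2) = 6 * real p - 2 * (real p + 1)" "3 * (H 0 - H 2) = (5 - real p) * s4 (int p)"
    using one odd c4 by simp_all
  \<comment> \<open>The classes of p - 1 and p + 1 are 0 and 2 for p = 1 modulo 4 and are exchanged
    for p = 3; the sign of s4 p accounts for the exchange.\<close>
  then have H02: "6 * H 0 = 4 * real p - 2 + (5 - real p) * s4 (int p)" "6 * H 2 = 4 * real p - 2 - (5 - real p) * s4 (int p)"
    by (simp_all add: algebra_simps)
  have shift: "(int p + 1) mod 4 = (int p mod 4 + 1) mod 4" "(int p - 1) mod 4 = (int p mod 4 - 1) mod 4"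
    by (simp_all add: mod_simps)
  show ?thesis
    using p4 H1 H02 unfolding S cong_def shift ip by (auto simp: s4_def ip)
qed

end
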